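(* Let $\mathbf{X}$ and $\mathbf{Y}$ be non-degenerate random vectors in $\mathbb{R}^d$ ($d\ge1$) with joint cumulative distribution functions $F(\mathbf{x})=\mathrm{P}(\mathbf{X}\le\mathbf{x})$ and $G(\mathbf{x})=\mathrm{P}(\mathbf{Y}\le\mathbf{x})$, and assume $F\neq G$. Let $F_n$ be the empirical distribution function of a random sample $\mathbf{X}_1,\dots,\mathbf{X}_n$ from $\mathbf{X}$, and let $\mathbb{B}_F$ be an $F$-Brownian bridge. For $\phi\in\{\delta,\sigma,\alpha\}$, where $\delta(f)=\|f\|_\infty$, $\sigma(f)=\sup f$, $\alpha(f)=\sup f-\inf f$, set $$D_n(\phi)=\sqrt{n}\,\big(\phi(F_n-G)-\phi(F-G)\big).$$ Then, as $n\to\infty$, $D_n(\phi)$ converges in distribution to $\phi'_{F-G}(\mathbb{B}_F)$, where, for $f\in\mathcal{D}(\bar{\mathbb{R}}^d)\setminus\{0\}$ and $g\in\mathcal{D}(\bar{\mathbb{R}}^d)$, $$\delta'_f(g)=\max_{\mathbf{v}\in\mathcal{V}}\sup_{M^+_{\mathbf{v}}(|f|)}\big(g_{\mathbf{v}}\cdot\operatorname{sgn}(f_{\mathbf{v}})\big),\qquad \sigma'_f(g)=\max_{\mathbf{v}\in\mathcal{V}}\sup_{M^+_{\mathbf{v}}(f)}g_{\mathbf{v}},\qquad \alpha'_f(g)=\max_{\mathbf{v}\in\mathcal{V}}\sup_{M^+_{\mathbf{v}}(f)}g_{\mathbf{v}}-\min_{\mathbf{v}\in\mathcal{V}}\inf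_{M^-_{\mathbf{v}}(f)}g_{\mathbf{v}}.$$
   Context: $\le$ is the coordinatewise order on $\mathbb{R}^d$; $F_n(\mathbf{x})=\frac1n\sum_{i=1}^n1_{\{\mathbf{X}_i\le\mathbf{x}\}}$. Distribution functions are regarded as functions on $\bar{\mathbb{R}}^d$, $\bar{\mathbb{R}}=[-\infty,+\infty]$ (extended naturally); $\bar{\mathbb{R}}^d$ is topologized via a homeomorphism with $[0,1]^d$. $\ell^\infty(\bar{\mathbb{R}}^d)$ is the space of bounded real functions with the supremum norm. The $F$-Brownian bridge $\mathbb{B}_F$ is the weak limit in $\ell^\infty(\bar{\mathbb{R}}^d)$ of the empirical process $\sqrt{n}(F_n-F)$: a centered Gaussian process with covariance $\mathrm{E}(\mathbb{B}_F(\mathbf{x})\mathbb{B}_F(\mathbf{y}))=F(\mathbf{x}\wedge\mathbf{y})-F(\mathbf{x})F(\mathbf{y})$, where $\wedge$ is the coordinatewise minimum. Quadrants: $\mathcal{V}=\{-1,1\}^d$. For $x\in\bar{\mathbb{R}}$, $I_{-1}(x)=[-\infty,x)$ (empty if $x=-\infty$) and $I_{+1}(x)=(x,+\infty]$ (empty if $x=+\infty$). For $\mathbf{v}\in\mathcal{V}$, $\mathbf{x}\in\bar{\mathbb{R}}^d$, $Q_{\mathbf{v}}(\mathbf{x})=I_{v_1}(x_1)\times\cdots\times I_{v_d}(x_d)$. A number $l\in\mathbb{R}$ is the $\mathbf{v}$-limit of $f:\bar{\mathbb{R}}^d\to\mathbb{R}$ at $\mathbf{x}$, denoted $f_{\mathbf{v}}(\mathbf{x})$,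 if $Q_{\mathbf{v}}(\mathbf{x})\neq\emptyset$ and $f(\mathbf{x}_n)\to l$ for every sequence $\{\mathbf{x}_n\}\subset Q_{\mathbf{v}}(\mathbf{x})$ with $\mathbf{x}_n\to\mathbf{x}$. Let $\mathbf{v}_{\mathbf{x}}\in\mathcal{V}$ have $i$-th coordinate $+1$ if $x_i<+\infty$ and $-1$ if $x_i=+\infty$. $f$ is continuous from above if for every $\mathbf{x}$ the limit $f_{\mathbf{v}_{\mathbf{x}}}(\mathbf{x})$ exists and equals $f(\mathbf{x})$. The Skorohod space $\mathcal{D}(\bar{\mathbb{R}}^d)\subset\ell^\infty(\bar{\mathbb{R}}^d)$ is the collection of continuous from above $f:\bar{\mathbb{R}}^d\to\mathbb{R}$ such that $f_{\mathbf{v}}(\mathbf{x})$ exists whenever $Q_{\mathbf{v}}(\mathbf{x})\ne\emptyset$. For $h\in\mathcal{D}(\bar{\mathbb{R}}^d)$, $M^+_{\mathbf{v}}(h)=\{\mathbf{x}\in\bar{\mathbb{R}}^d:Q_{\mathbf{v}}(\mathbf{x})\ne\emptyset,\ h_{\mathbf{v}}(\mathbf{x})=\sup h\}$ and $M^-_{\mathbf{v}}(h)=\{\mathbf{x}\in\bar{\mathbb{R}}^d:Q_{\mathbf{v}}(\mathbf{x})\ne\emptyset,\ h_{\mathbf{v}}(\mathbf{x})=\inf h\}$. Suprema (infima) over the empty set are $-\infty$ ($+\infty$); $\operatorname{sgn}$ is the sign function. $F-G$ and (a.s.) the paths of $\sqrt n(F_n-F)$ and $\mathbb{B}_F$ lie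 in $\mathcal{D}(\bar{\mathbb{R}}^d)$. *)

theory Defs
  imports "HOL-Probability.Probability"
begin

section \<open>Distribution functions on the extended space\<close>

definition ereal_vec :: "real ^ 'd \<Rightarrow> ereal ^ 'd" where
  "ereal_vec y = (\<chi> i. ereal (y $ i))"

text \<open>The order on vectors is the coordinatewise one and \<open>ereal ^ 'd\<close> carries the product of the
  order topologies, hence is homeomorphic to a cube.  Evaluating \<open>P(X \<le> x)\<close> at extended points
  \<open>x\<close> gives the natural extension: \<open>0\<close> if some coordinate of \<open>x\<close> is \<open>-\<infinity>\<close>, and marginal
  distribution functions if some coordinates are \<open>+\<infinity>\<close>.\<close>

definition joint_cdf :: "'a measure \<Rightarrow> ('a \<Rightarrow> real ^ 'd) \<Rightarrow> ereal ^ 'd \<Rightarrow> real" where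
  "joint_cdf M X x = measure M {\<omega> \<in> space M. ereal_vec (X \<omega>) \<le> x}"

text \<open>The sample is indexed from \<open>0\<close>; the empirical distribution function of size \<open>n\<close> uses the
  indices below \<open>n\<close>.  The value at \<open>n = 0\<close> is immaterial.\<close>

definition emp_cdf :: "(nat \<Rightarrow> 'a \<Rightarrow> real ^ 'd) \<Rightarrow> nat \<Rightarrow> 'a \<Rightarrow> ereal ^ 'd \<Rightarrow> real" where
  "emp_cdf S n \<omega> x = (1 / real n) * (\<Sum>i<n. if ereal_vec (S i \<omega>) \<le> x then 1 else 0)"

definition random_sample ::
    "'c measure \<Rightarrow> (nat \<Rightarrow> 'c \<Rightarrow> real ^ 'd) \<Rightarrow> 'a measure \<Rightarrow> ('a \<Rightarrow> real ^ 'd) \<Rightarrow> bool" where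
  "random_sample M S MX X \<longleftrightarrow>
     prob_space M \<and> prob_space.indep_vars M (\<lambda>_. borel) S UNIV \<and>
     (\<forall>i. distr M borel (S i) = distr MX borel X)"

definition nondegenerate :: "'a measure \<Rightarrow> ('a \<Rightarrow> real ^ 'd) \<Rightarrow> bool" where
  "nondegenerate M X \<longleftrightarrow> \<not> (\<exists>c. AE \<omega> in M. X \<omega> = c)"

section \<open>The space of bounded functions and the Skorohod space\<close>

abbreviation linf :: "(ereal ^ 'd \<Rightarrow> real) metric" where
  "linf \<equiv> funspace UNIV euclidean_metric"

definition quadrants :: "(int ^ 'd) set" where
  "quadrants = {v. \<forall>i. v $ i \<in> {-1, 1}}"

definition half_line :: "int \<Rightarrow> ereal \<Rightarrow> ereal set" where
  "half_line s x = (if s = 1 then {x<..} else {..<x})"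

definition quadrant :: "int ^ 'd \<Rightarrow> ereal ^ 'd \<Rightarrow> (ereal ^ 'd) set" where
  "quadrant v x = {y. \<forall>i. y $ i \<in> half_line (v $ i) (x $ i)}"

definition is_vlimit ::
    "int ^ 'd \<Rightarrow> (ereal ^ 'd \<Rightarrow> real) \<Rightarrow> ereal ^ 'd \<Rightarrow> real \<Rightarrow> bool" where
  "is_vlimit v f x l \<longleftrightarrow> quadrant v x \<noteq> {} \<and>
     (\<forall>s. (\<forall>n. s n \<in> quadrant v x) \<longrightarrow> s \<longlonglongrightarrow> x \<longrightarrow> (\<lambda>n. f (s n)) \<longlonglongrightarrow> l)"

text \<open>A nonempty quadrant at \<open>x\<close> accumulates at \<open>x\<close>, so the limit is unique if it exists.\<close>

definition vlim :: "int ^ 'd \<Rightarrow> (ereal ^ 'd \<Rightarrow> real) \<Rightarrow> ereal ^ 'd \<Rightarrow> real" where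
  "vlim v f x = (THE l. is_vlimit v f x l)"

definition upper_dir :: "ereal ^ 'd \<Rightarrow> int ^ 'd" where
  "upper_dir x = (\<chi> i. if x $ i < \<infinity> then 1 else -1)"

definition cont_from_above :: "(ereal ^ 'd \<Rightarrow> real) \<Rightarrow> bool" where
  "cont_from_above f \<longleftrightarrow> (\<forall>x. is_vlimit (upper_dir x) f x (f x))"

definition skorohod :: "(ereal ^ 'd \<Rightarrow> real) set" where
  "skorohod = {f \<in> mspace linf. cont_from_above f \<and>
     (\<forall>x. \<forall>v\<in>quadrants. quadrant v x \<noteq> {} \<longrightarrow> (\<exists>l. is_vlimit v f x l))}"

section \<open>The functionals and their directional derivatives\<close>

definition delta :: "(ereal ^ 'd \<Rightarrow> real) \<Rightarrow> real" where
  "delta f = (SUP x. \<bar>f x\<bar>)"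

definition sigma_sup :: "(ereal ^ 'd \<Rightarrow> real) \<Rightarrow> real" where
  "sigma_sup f = (SUP x. f x)"

definition alpha :: "(ereal ^ 'd \<Rightarrow> real) \<Rightarrow> real" where
  "alpha f = (SUP x. f x) - (INF x. f x)"

definition M_plus :: "int ^ 'd \<Rightarrow> (ereal ^ 'd \<Rightarrow> real) \<Rightarrow> (ereal ^ 'd) set" where
  "M_plus v h = {x. quadrant v x \<noteq> {} \<and> vlim v h x = (SUP y. h y)}"

definition M_minus :: "int ^ 'd \<Rightarrow> (ereal ^ 'd \<Rightarrow> real) \<Rightarrow> (ereal ^ 'd) set" where
  "M_minus v h = {x. quadrant v x \<noteq> {} \<and> vlim v h x = (INF y. h y)}"

text \<open>The derivatives take values in \<open>ereal\<close>, where the supremum (infimum) of the empty set is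
  \<open>-\<infinity>\<close> (\<open>+\<infinity>\<close>).  They are partial functions with domain \<open>f \<in> skorohod - {0}\<close>, \<open>g \<in> skorohod\<close>,
  left unspecified elsewhere.\<close>

definition deriv_dom :: "(ereal ^ 'd \<Rightarrow> real) \<Rightarrow> (ereal ^ 'd \<Rightarrow> real) \<Rightarrow> bool" where
  "deriv_dom f g \<longleftrightarrow> f \<in> skorohod - {\<lambda>_. 0} \<and> g \<in> skorohod"

definition delta_deriv :: "(ereal ^ 'd \<Rightarrow> real) \<Rightarrow> (ereal ^ 'd \<Rightarrow> real) \<Rightarrow> ereal" where
  "delta_deriv f g =
     (if deriv_dom f g
      then MAX v\<in>quadrants. SUP x\<in>M_plus v (\<lambda>y. \<bar>f y\<bar>). ereal (vlim v g x * sgn (vlim v f x))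
      else undefined)"

definition sigma_deriv :: "(ereal ^ 'd \<Rightarrow> real) \<Rightarrow> (ereal ^ 'd \<Rightarrow> real) \<Rightarrow> ereal" where
  "sigma_deriv f g =
     (if deriv_dom f g
      then MAX v\<in>quadrants. SUP x\<in>M_plus v f. ereal (vlim v g x)
      else undefined)"

definition alpha_deriv :: "(ereal ^ 'd \<Rightarrow> real) \<Rightarrow> (ereal ^ 'd \<Rightarrow> real) \<Rightarrow> ereal" where
  "alpha_deriv f g =
     (if deriv_dom f g
      then (MAX v\<in>quadrants. SUP x\<in>M_plus v f. ereal (vlim v g x))
         - (MIN v\<in>quadrants. INF x\<in>M_minus v f. ereal (vlim v g x))
      else undefined)"

section \<open>Weak convergence and the Brownian bridge\<close>

text \<open>Elements of a nonseparable metric space such as \<^term>\<open>linf\<close> need not be Borel measurable as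
  functions of the sample, so weak convergence is taken in the sense of Hoffmann-Joergensen:
  outer expectations along the sequence, a Borel measurable limit.\<close>

definition outer_expectation :: "'a measure \<Rightarrow> ('a \<Rightarrow> real) \<Rightarrow> real" where
  "outer_expectation M T =
     Inf {integral\<^sup>L M U | U. integrable M U \<and> (\<forall>\<omega>\<in>space M. T \<omega> \<le> U \<omega>)}"

definition converges_weakly ::
    "'e metric \<Rightarrow> 'a measure \<Rightarrow> (nat \<Rightarrow> 'a \<Rightarrow> 'e) \<Rightarrow> 'b measure \<Rightarrow> ('b \<Rightarrow> 'e) \<Rightarrow> bool" where
  "converges_weakly E M W N B \<longleftrightarrow>
     (\<forall>n. \<forall>\<omega>\<in>space M. W n \<omega> \<in> mspace E) \<and>
     B \<in> N \<rightarrow>\<^sub>M sigma (mspace E) {U. openin (mtopology_of E) U} \<and>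
     (\<forall>H. continuous_map (mtopology_of E) euclideanreal H \<longrightarrow> bounded (H ` mspace E) \<longrightarrow>
        (\<lambda>n. outer_expectation M (\<lambda>\<omega>. H (W n \<omega>))) \<longlonglongrightarrow> integral\<^sup>L N (\<lambda>\<omega>. H (B \<omega>)))"

text \<open>Point masses count as normal distributions (with variance \<open>0\<close>).\<close>

definition gaussian_rv :: "'b measure \<Rightarrow> ('b \<Rightarrow> real) \<Rightarrow> bool" where
  "gaussian_rv N Z \<longleftrightarrow> Z \<in> borel_measurable N \<and>
     (\<exists>m. (AE \<omega> in N. Z \<omega> = m) \<or> (\<exists>s>0. distributed N lborel Z (normal_density m s)))"

definition centered_gaussian_process :: "'b measure \<Rightarrow> ('b \<Rightarrow> 't \<Rightarrow> real) \<Rightarrow> bool" where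
  "centered_gaussian_process N B \<longleftrightarrow>
     (\<forall>T a. finite T \<longrightarrow> gaussian_rv N (\<lambda>\<omega>. \<Sum>t\<in>T. a t * B \<omega> t)) \<and>
     (\<forall>t. integral\<^sup>L N (\<lambda>\<omega>. B \<omega> t) = 0)"

text \<open>The \<open>F\<close>-Brownian bridge, where \<open>F\<close> is the distribution function of the probability law
  \<open>\<mu>\<close>.  The empirical process is that of the coordinate sample on the infinite product of \<open>\<mu>\<close>,
  so the notion does not refer to any particular sample.\<close>

definition brownian_bridge ::
    "(real ^ 'd) measure \<Rightarrow> 'b measure \<Rightarrow> ('b \<Rightarrow> ereal ^ 'd \<Rightarrow> real) \<Rightarrow> bool" where
  "brownian_bridge \<mu> N B \<longleftrightarrow>
     (let F = joint_cdf \<mu> (\<lambda>y. y) in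
      prob_space N \<and>
      converges_weakly linf
        (PiM (UNIV :: nat set) (\<lambda>_. \<mu>))
        (\<lambda>n s x. sqrt (real n) * (emp_cdf (\<lambda>i s. s i) n s x - F x))
        N B \<and>
      centered_gaussian_process N B \<and>
      (\<forall>x y. integral\<^sup>L N (\<lambda>\<omega>. B \<omega> x * B \<omega> y) =
         F (\<chi> i. min (x $ i) (y $ i)) - F x * F y))"

text \<open>Convergence in distribution of real random variables.  The limit is given as an almost surely
  finite, \<open>ereal\<close>-valued map.  It is a random variable on the completion of its probability space
  since the derivatives above are unspecified on the null set where the path is not in
  \<open>skorohod\<close>.\<close>

definition converges_in_distribution ::
    "'a measure \<Rightarrow> (nat \<Rightarrow> 'a \<Rightarrow> real) \<Rightarrow> 'b measure \<Rightarrow> ('b \<Rightarrow> ereal) \<Rightarrow> bool" where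
  "converges_in_distribution M D N Z \<longleftrightarrow>
     (\<forall>n. D n \<in> borel_measurable M) \<and>
     Z \<in> borel_measurable (completion N) \<and>
     (AE \<omega> in N. \<bar>Z \<omega>\<bar> \<noteq> \<infinity>) \<and>
     weak_conv_m (\<lambda>n. distr M borel (D n))
       (distr (completion N) borel (\<lambda>\<omega>. real_of_ereal (Z \<omega>)))"

end

theory Submission
  imports Defs
begin

text \<open>All three functionals \<open>\<phi>\<close> are convex and Lipschitz for the supremum norm, so the difference
  quotients \<open>\<phi>\<^sub>n(h) = \<surd>n (\<phi>(f + h/\<surd>n) - \<phi>(f))\<close>, where \<open>f = F - G\<close>, decrease in \<open>n\<close> to a Lipschitz
  limit \<open>\<Phi>(h)\<close>.  With \<open>W\<^sub>n = \<surd>n (F\<^sub>n - F)\<close> one has \<open>D\<^sub>n = \<phi>\<^sub>n(W\<^sub>n)\<close> and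
  \<open>\<Phi>(W\<^sub>n) \<le> \<phi>\<^sub>n(W\<^sub>n) \<le> \<phi>\<^sub>m(W\<^sub>n)\<close> for \<open>m \<le> n\<close>; testing with monotone continuous functions and letting
  first \<open>n\<close>, then \<open>m\<close> tend to infinity gives \<open>D\<^sub>n \<rightarrow> \<Phi>(B)\<close> in distribution.

  The Skorohod space is closed and contains the paths of \<open>W\<^sub>n\<close>, hence almost every path of \<open>B\<close>.  For
  \<open>g\<close> in that space \<open>\<Phi>(g)\<close> is given by the stated formula: near each point \<open>x\<close> and inside each quadrant
  at \<open>x\<close> the functions \<open>f\<close>, \<open>g\<close> are close to their quadrant limits, which controls \<open>f + t g\<close> there for
  small \<open>t\<close>, and the extended space is compact.\<close>

section \<open>Quadrants of the extended space\<close>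

lemma open_vec_contains_box:
  assumes "open S" "x \<in> S"
  shows "\<exists>A. (\<forall>i. open (A i) \<and> x $ i \<in> A i) \<and> (\<forall>y. (\<forall>i. y $ i \<in> A i) \<longrightarrow> y \<in> S)"
  using assms unfolding open_vec_def by blast

lemma open_vec_box:
  assumes "\<And>i. open (A i)"
  shows "open {y. \<forall>i. y $ i \<in> A i}"
  unfolding open_vec_def using assms by blast

text \<open>Quadrant limits are defined through sequences; first countability is what lets
  \<open>is_vlimit_iff_tendsto\<close> replace them by filter limits. Boxes built from countable
  local bases of the finitely many coordinates form a countable local base.\<close>

instance vec :: (first_countable_topology, finite) first_countable_topology
proof
  fix x :: "'a ^ 'b"
  have "\<exists>K. countable K \<and> (\<forall>a\<in>K. x $ i \<in> a \<and> open a) \<and>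
      (\<forall>S. open S \<longrightarrow> x $ i \<in> S \<longrightarrow> (\<exists>a\<in>K. a \<subseteq> S))" for i
    using first_countable_basisE[of "x $ i"] by metis
  then obtain K where K: "\<And>i. countable (K i)" "\<And>i a. a \<in> K i \<Longrightarrow> x $ i \<in> a \<and> open a"
      "\<And>i S. open S \<Longrightarrow> x $ i \<in> S \<Longrightarrow> \<exists>a\<in>K i. a \<subseteq> S"
    by metis
  define box where "box = (\<lambda>A::'b \<Rightarrow> 'a set. {y::'a ^ 'b. \<forall>i. y $ i \<in> A i})"
  show "\<exists>A::nat \<Rightarrow> ('a ^ 'b) set. (\<forall>i. x \<in> A i \<and> open (A i)) \<and>
      (\<forall>S. open S \<and> x \<in> S \<longrightarrow> (\<exists>i. A i \<subseteq> S))"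
  proof (rule first_countableI[of "box ` (PiE UNIV K)"])
    show "countable (box ` (PiE UNIV K))"
      using K(1) by (intro countable_image countable_PiE) auto
  next
    fix U assume "U \<in> box ` (PiE UNIV K)"
    then show "x \<in> U" "open U"
      using K(2) unfolding box_def PiE_UNIV_domain
      by (auto simp: Pi_iff intro!: open_vec_box)
  next
    fix S assume "open S" "x \<in> S"
    then obtain A where A: "\<forall>i. open (A i) \<and> x $ i \<in> A i"
        "\<forall>y. (\<forall>i. y $ i \<in> A i) \<longrightarrow> y \<in> S"
      by (auto dest: open_vec_contains_box)
    have "\<exists>a\<in>K i. a \<subseteq> A i" for i
      using A(1) by (intro K(3)) auto
    then obtain C where C: "\<And>i. C i \<in> K i \<and> C i \<subseteq> A i"
      by metis
    have "box C \<in> box ` (PiE UNIV K)" "box C \<subseteq> S"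
      using C A(2) unfolding box_def by (auto simp: subset_iff)
    then show "\<exists>a\<in>box ` (PiE UNIV K). a \<subseteq> S" by blast
  qed
qed

text \<open>Such a set reduces the supremum of a Skorohod function to countably many evaluations,
  which is how \<open>sigma_sup\<close> becomes measurable.\<close>

lemma countable_dense_ereal_vec:
  obtains E :: "(ereal ^ 'd) set"
  where "countable E" "\<And>U. open U \<Longrightarrow> U \<noteq> {} \<Longrightarrow> \<exists>e\<in>E. e \<in> U"
proof -
  obtain D :: "ereal set" where D: "countable D" "\<And>A. open A \<Longrightarrow> A \<noteq> {} \<Longrightarrow> \<exists>d\<in>D. d \<in> A"
    by (rule countable_dense_setE) blast
  define E :: "(ereal ^ 'd) set" where "E = (\<lambda>f. \<chi> i. f i) ` (PiE UNIV (\<lambda>_. D))"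
  show thesis
  proof
    show "countable E"
      unfolding E_def using D(1) by (intro countable_image countable_PiE) auto
    fix U :: "(ereal ^ 'd) set" assume "open U" "U \<noteq> {}"
    then obtain x where "x \<in> U" by blast
    with \<open>open U\<close> obtain A where A: "\<forall>i. open (A i) \<and> x $ i \<in> A i"
        "\<forall>y. (\<forall>i. y $ i \<in> A i) \<longrightarrow> y \<in> U"
      by (auto dest: open_vec_contains_box)
    have "\<exists>d\<in>D. d \<in> A i" for i
      using A(1) by (intro D(2)) auto
    then obtain d where d: "\<And>i. d i \<in> D \<and> d i \<in> A i" by metis
    have "(\<chi> i. d i) \<in> E" "(\<chi> i. d i) \<in> U"
      using d A(2) unfolding E_def by auto
    then show "\<exists>e\<in>E. e \<in> U" by blast
  qed
qed

lemma compact_UNIV_ereal_vec: "compact (UNIV :: (ereal ^ 'd) set)"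
proof -
  \<comment> \<open>Tychonoff's theorem applies to functions on the index type; compactness then
    moves to vectors along a continuous surjection.\<close>
  have "compact_space (product_topology (\<lambda>_::'d. euclidean :: ereal topology) UNIV)"
    unfolding compact_space_product_topology
    by (auto simp: compact_space_def Extended_Real_Limits.compact_UNIV)
  then have "compact (UNIV :: ('d \<Rightarrow> ereal) set)"
    by (simp add: compact_space_def euclidean_product_topology)
  moreover have "continuous_on UNIV (\<lambda>f::'d \<Rightarrow> ereal. \<chi> i. f i)"
    by (intro continuous_on_vec_lambda continuous_intros) (rule continuous_on_product_coordinates)
  ultimately have "compact (range (\<lambda>f::'d \<Rightarrow> ereal. \<chi> i. f i))"
    by (rule compact_continuous_image[rotated])
  moreover have "range (\<lambda>f::'d \<Rightarrow> ereal. \<chi> i. f i) = UNIV"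
    by (metis surjI vec_nth_inverse)
  ultimately show ?thesis by simp
qed

section \<open>Quadrants and limits inside them\<close>

lemma notin_quadrant: "x \<notin> quadrant v x"
  by (auto simp: quadrant_def half_line_def)

lemma open_quadrant: "open (quadrant v x)"
proof -
  have "open {y. y $ i \<in> half_line (v $ i) (x $ i)}" for i
    unfolding half_line_def by (intro open_vimage_vec_nth[unfolded vimage_def]) auto
  then show ?thesis
    unfolding quadrant_def Collect_all_eq by (intro open_INT) auto
qed

lemma finite_quadrants: "finite (quadrants :: (int ^ 'd) set)"
proof -
  have "quadrants \<subseteq> (\<lambda>f. \<chi> i. f i) ` (PiE (UNIV :: 'd set) (\<lambda>_. {-1, 1}))"
    by (force simp: quadrants_def image_iff vec_eq_iff intro!: bexI[of _ "vec_nth _"])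
  moreover have "finite ((\<lambda>f. \<chi> i. f i) ` (PiE (UNIV :: 'd set) (\<lambda>_. {-1, 1::int})))"
    by (intro finite_imageI finite_PiE) auto
  ultimately show ?thesis by (rule finite_subset)
qed

lemma upper_dir_in_quadrants: "upper_dir x \<in> quadrants"
  by (simp add: upper_dir_def quadrants_def)

lemma quadrants_nonempty: "quadrants \<noteq> {}"
  using upper_dir_in_quadrants by blast

lemma quadrant_upper_dir_nonempty: "quadrant (upper_dir x) x \<noteq> {}"
proof -
  have "(\<chi> i. if x $ i < \<infinity> then \<infinity> else 0) \<in> quadrant (upper_dir x) x"
    by (auto simp: quadrant_def half_line_def upper_dir_def)
  then show ?thesis by blast
qed

lemma half_line_accumulates:
  assumes "half_line s x \<noteq> {}" "open A" "x \<in> A"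
  shows "A \<inter> half_line s x \<noteq> {}"
proof (cases "s = 1")
  case True
  then obtain z where "x < z" using assms(1) by (auto simp: half_line_def)
  then obtain b where "b > x" "{x..<b} \<subseteq> A" using open_right[OF assms(2,3)] by blast
  moreover obtain c where "x < c" "c < b" using dense[OF \<open>b > x\<close>] by blast
  ultimately have "c \<in> A \<inter> half_line s x" using True by (auto simp: half_line_def)
  then show ?thesis by blast
next
  case False
  then obtain z where "z < x" using assms(1) by (auto simp: half_line_def)
  then obtain b where "b < x" "{b<..x} \<subseteq> A" using open_left[OF assms(2,3)] by blast
  moreover obtain c where "b < c" "c < x" using dense[OF \<open>b < x\<close>] by blast
  ultimately have "c \<in> A \<inter> half_line s x" using False by (auto simp: half_line_def)
  then show ?thesis by blast
qed

text \<open>Density of the order in each coordinate puts points of a nonempty quadrant into every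
  neighbourhood of \<open>x\<close>. Nontriviality of the filter makes quadrant limits unique and
  lets non-strict inequalities pass to them.\<close>

lemma at_within_quadrant_neq_bot:
  assumes "quadrant v x \<noteq> {}"
  shows "at x within quadrant v x \<noteq> bot"
proof -
  have "\<exists>y\<in>quadrant v x. y \<in> U" if U: "open U" "x \<in> U" for U
  proof -
    obtain A where A: "\<forall>i. open (A i) \<and> x $ i \<in> A i"
        "\<forall>y. (\<forall>i. y $ i \<in> A i) \<longrightarrow> y \<in> U"
      using open_vec_contains_box[OF U] by auto
    have "half_line (v $ i) (x $ i) \<noteq> {}" for i
      using assms by (auto simp: quadrant_def)
    then have "\<exists>z. z \<in> A i \<inter> half_line (v $ i) (x $ i)" for i
      unfolding ex_in_conv using A(1) by (intro half_line_accumulates) auto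
    then obtain z where z: "\<And>i. z i \<in> A i \<inter> half_line (v $ i) (x $ i)" by metis
    show ?thesis
      by (rule bexI[of _ "\<chi> i. z i"]) (use z A(2) in \<open>auto simp: quadrant_def\<close>)
  qed
  then show ?thesis
    unfolding trivial_limit_def eventually_at_topological
    by (metis notin_quadrant)
qed

text \<open>First countability equates sequential and filter limits; excluding the point
  \<open>x\<close> changes nothing, as \<open>x\<close> lies in no quadrant at itself. The limit
  calculus of filters is available from here on.\<close>

lemma is_vlimit_iff_tendsto:
  "is_vlimit v f x l \<longleftrightarrow> quadrant v x \<noteq> {} \<and> (f \<longlongrightarrow> l) (at x within quadrant v x)"
  unfolding is_vlimit_def tendsto_at_iff_sequentially comp_def
  using notin_quadrant[of x v] by auto

lemma vlim_eqI:
  assumes "is_vlimit v f x l"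
  shows "vlim v f x = l"
  unfolding vlim_def
proof (rule the_equality)
  show "is_vlimit v f x l" by (fact assms)
  fix l' assume "is_vlimit v f x l'"
  then show "l' = l"
    using assms tendsto_unique[OF at_within_quadrant_neq_bot] unfolding is_vlimit_iff_tendsto
    by blast
qed

lemma skorohod_tendsto_vlim:
  assumes "f \<in> skorohod" "v \<in> quadrants" "quadrant v x \<noteq> {}"
  shows "(f \<longlongrightarrow> vlim v f x) (at x within quadrant v x)"
proof -
  obtain l where "is_vlimit v f x l"
    using assms by (auto simp: skorohod_def)
  then show ?thesis
    using vlim_eqI is_vlimit_iff_tendsto by blast
qed

lemma skorohod_tendsto_upper:
  assumes "f \<in> skorohod"
  shows "(f \<longlongrightarrow> f x) (at x within quadrant (upper_dir x) x)"
  using assms by (auto simp: skorohod_def cont_from_above_def is_vlimit_iff_tendsto)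

lemma vlim_tendstoI:
  assumes "quadrant v x \<noteq> {}" "(f \<longlongrightarrow> l) (at x within quadrant v x)"
  shows "vlim v f x = l"
  using assms vlim_eqI is_vlimit_iff_tendsto by blast

lemma skorohodI:
  assumes "f \<in> mspace linf"
    and "\<And>x. (f \<longlongrightarrow> f x) (at x within quadrant (upper_dir x) x)"
    and "\<And>x v. v \<in> quadrants \<Longrightarrow> quadrant v x \<noteq> {} \<Longrightarrow>
           \<exists>l. (f \<longlongrightarrow> l) (at x within quadrant v x)"
  shows "f \<in> skorohod"
  unfolding skorohod_def cont_from_above_def is_vlimit_iff_tendsto
  using assms quadrant_upper_dir_nonempty by blast

section \<open>From single quadrants to uniform bounds by compactness\<close>

lemma mem_quadrantI:
  assumes "\<And>i. y $ i \<noteq> x $ i"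
  shows "y \<in> quadrant (\<chi> i. if x $ i < y $ i then 1 else -1) x"
  using assms by (auto simp: quadrant_def half_line_def not_less order_le_less)

text \<open>Points near \<open>x\<close> sharing a coordinate with \<open>x\<close> lie in no quadrant at \<open>x\<close>; by \<open>closed\<close> the
  property carries over to them from nearby points that do.\<close>

lemma eventually_quadrants_imp_uniform:
  fixes P :: "real \<Rightarrow> ereal ^ 'd \<Rightarrow> bool"
  assumes local: "\<And>x v. v \<in> quadrants \<Longrightarrow> quadrant v x \<noteq> {} \<Longrightarrow>
      \<exists>t0>0. \<forall>\<^sub>F y in at x within quadrant v x. \<forall>t. 0 < t \<longrightarrow> t < t0 \<longrightarrow> P t y"
    and closed: "\<And>x t. 0 < t \<Longrightarrow>
      (\<forall>\<^sub>F y in at x within quadrant (upper_dir x) x. P t y) \<Longrightarrow> P t x"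
  shows "\<exists>t0>0. \<forall>t y. 0 < t \<longrightarrow> t < t0 \<longrightarrow> P t y"
proof -
  define R where "R S r \<longleftrightarrow> (\<forall>t y. 0 < t \<longrightarrow> t < r \<longrightarrow> y \<in> S \<longrightarrow> P t y)" for S r
  have R: "P t y" if "R S r" "0 < t" "t < r" "y \<in> S" for S r t y
    using that by (simp add: R_def)
  \<comment> \<open>Near each point a common threshold comes from the finitely many quadrants;
    compactness then reduces the points themselves to finitely many.\<close>
  have "\<exists>U r. open U \<and> x \<in> U \<and> 0 < r \<and> R U r" for x
  proof -
    have "\<exists>U r. open U \<and> x \<in> U \<and> 0 < r \<and> R (U \<inter> quadrant v x) r" if v: "v \<in> quadrants" for v
    proof (cases "quadrant v x = {}")
      case True
      then show ?thesis by (intro exI[of _ UNIV] exI[of _ 1]) (auto simp: R_def)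
    next
      case False
      obtain r where r: "r > 0"
        and ev: "\<forall>\<^sub>F y in at x within quadrant v x. \<forall>t. 0 < t \<longrightarrow> t < r \<longrightarrow> P t y"
        using local[OF v False] by auto
      obtain U where U: "open U" "x \<in> U"
        and P: "\<forall>y\<in>U. y \<noteq> x \<longrightarrow> y \<in> quadrant v x \<longrightarrow> (\<forall>t. 0 < t \<longrightarrow> t < r \<longrightarrow> P t y)"
        using ev unfolding eventually_at_topological by auto
      have "R (U \<inter> quadrant v x) r"
        unfolding R_def using P notin_quadrant[of x v] by auto
      then show ?thesis using U r by blast
    qed
    then obtain U r where U: "\<And>v. v \<in> quadrants \<Longrightarrow> open (U v) \<and> x \<in> U v \<and> 0 < r v \<and>
        R (U v \<inter> quadrant v x) (r v)"
      by metis
    define O' where "O' = (\<Inter>v\<in>quadrants. U v)"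
    define s where "s = Min (r ` quadrants)"
    have O': "open O'" "x \<in> O'"
      using U finite_quadrants unfolding O'_def by (auto intro!: open_INT)
    have "finite (r ` quadrants)" "r ` quadrants \<noteq> {}"
      by (simp_all add: finite_quadrants quadrants_nonempty)
    then have s: "s > 0" "\<And>v. v \<in> quadrants \<Longrightarrow> s \<le> r v"
      unfolding s_def using U by auto
    have "P t y" if t: "0 < t" "t < s" and y: "y \<in> O'" for t y
    proof (rule closed[OF t(1)])
      \<comment> \<open>The point \<open>y\<close> may share coordinates with \<open>x\<close>.
        Close to \<open>y\<close> and inside its open upper quadrant no coordinate equals that of
        \<open>x\<close>: shared ones move strictly away, the others stay apart by continuity. So
        all these points lie in quadrants at \<open>x\<close>, and \<open>closed\<close> carries the
        property back to \<open>y\<close>.\<close>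
      let ?F = "at y within quadrant (upper_dir y) y"
      have "\<forall>\<^sub>F z in ?F. z $ i \<noteq> x $ i" for i
      proof (cases "y $ i = x $ i")
        case True
        have "\<forall>\<^sub>F z in ?F. z \<in> quadrant (upper_dir y) y"
          unfolding eventually_at_topological by auto
        then show ?thesis
          by eventually_elim
            (use True in \<open>auto simp: quadrant_def half_line_def split: if_splits dest!: spec[of _ i]\<close>)
      next
        case False
        have "((\<lambda>z. z $ i) \<longlongrightarrow> y $ i) ?F"
          by (intro tendsto_vec_nth tendsto_ident_at)
        then show ?thesis
          using False by (rule tendsto_imp_eventually_ne)
      qed
      then have "\<forall>\<^sub>F z in ?F. \<forall>i. z $ i \<noteq> x $ i"
        by (rule eventually_all_finite)
      moreover have "\<forall>\<^sub>F z in ?F. z \<in> O'"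
        unfolding eventually_at_topological using O'(1) y by auto
      ultimately show "\<forall>\<^sub>F z in ?F. P t z"
      proof eventually_elim
        case (elim z)
        define v :: "int ^ 'd" where "v = (\<chi> i. if x $ i < z $ i then 1 else -1)"
        have v: "v \<in> quadrants" by (simp add: v_def quadrants_def)
        have "z \<in> quadrant v x"
          unfolding v_def using elim by (intro mem_quadrantI) auto
        moreover have "z \<in> U v" using elim v by (simp add: O'_def)
        ultimately show ?case
          using U[OF v] s(2)[OF v] t by (intro R[of "U v \<inter> quadrant v x" "r v"]) simp_all
      qed
    qed
    then have "R O' s" by (simp add: R_def)
    then show ?thesis using O' s(1) by blast
  qed
  then obtain U r where U: "\<And>x. open (U x) \<and> x \<in> U x \<and> 0 < r x \<and> R (U x) (r x)"
    by metis
  obtain C where C: "finite C" "UNIV \<subseteq> (\<Union>c\<in>C. U c)"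
    by (rule compactE_image[OF compact_UNIV_ereal_vec, of UNIV U]) (use U in auto)
  then have "C \<noteq> {}" by auto
  show ?thesis
  proof (intro exI[of _ "Min (r ` C)"] conjI allI impI)
    show "0 < Min (r ` C)" using C \<open>C \<noteq> {}\<close> U by auto
    fix t y assume t: "0 < t" "t < Min (r ` C)"
    obtain c where c: "c \<in> C" "y \<in> U c" using C by auto
    have "Min (r ` C) \<le> r c" using C(1) c(1) by auto
    then show "P t y" using U[of c] t c by (intro R[of "U c" "r c"]) auto
  qed
qed

section \<open>Directional derivatives of supremum functionals\<close>

declare mspace_funspace [simp del] mdist_funspace [simp del]

section \<open>Bounded functions and the supremum metric\<close>

lemma mspace_linf_iff: "f \<in> mspace linf \<longleftrightarrow> (\<exists>c. \<forall>x. \<bar>f x\<bar> \<le> c)"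
  by (simp add: mspace_funspace Met_TC.fspace_def extensional_def bounded_iff)

lemma mspace_linf_add_scaled:
  assumes "f \<in> mspace linf" "g \<in> mspace linf"
  shows "(\<lambda>x. f x + t * g x) \<in> mspace linf"
proof -
  obtain a b where "\<And>x. \<bar>f x\<bar> \<le> a" "\<And>x. \<bar>g x\<bar> \<le> b"
    using assms unfolding mspace_linf_iff by blast
  then have "\<bar>f x + t * g x\<bar> \<le> a + \<bar>t\<bar> * b" for x
    by (intro order.trans[OF abs_triangle_ineq] add_mono) (auto simp: abs_mult mult_left_mono)
  then show ?thesis unfolding mspace_linf_iff by blast
qed

lemma abs_diff_le_mdist_linf:
  assumes "f \<in> mspace linf" "g \<in> mspace linf"
  shows "\<bar>f x - g x\<bar> \<le> mdist linf f g"
  using funspace_mdist_le[OF assms, of "mdist linf f g"] by (auto simp: dist_real_def)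

lemma mdist_linf_le:
  assumes "f \<in> mspace linf" "g \<in> mspace linf" "\<And>x. \<bar>f x - g x\<bar> \<le> c"
  shows "mdist linf f g \<le> c"
  using funspace_mdist_le[OF assms(1,2)] assms(3) by (auto simp: dist_real_def)

lemma Max_ereal_eq_SUP:
  fixes h :: "int ^ 'd \<Rightarrow> ereal"
  shows "(MAX v\<in>quadrants. h v) = (SUP v\<in>quadrants. h v)"
  by (rule Max_Sup) (simp_all add: finite_quadrants quadrants_nonempty)

lemma Min_ereal_eq_INF:
  fixes h :: "int ^ 'd \<Rightarrow> ereal"
  shows "(MIN v\<in>quadrants. h v) = (INF v\<in>quadrants. h v)"
  by (rule Min_Inf) (simp_all add: finite_quadrants quadrants_nonempty)

text \<open>The cases of interest are \<open>p a = a\<close>, \<open>D a b = b\<close> and \<open>p a = \<bar>a\<bar>\<close>, \<open>D a b = b * sgn a\<close>.\<close>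

lemma tendsto_difference_quotient_SUP:
  fixes f g :: "ereal ^ 'd \<Rightarrow> real" and p :: "real \<Rightarrow> real"
  defines "K \<equiv> SUP y. p (f y)"
  assumes f: "f \<in> skorohod" and g: "g \<in> skorohod"
    and lower: "\<And>a b t. 0 < t \<Longrightarrow> p a + t * D a b \<le> p (a + t * b)"
    and lip: "\<And>a b. \<bar>p a - p b\<bar> \<le> \<bar>a - b\<bar>"
    and upper: "\<And>a b c. p a = K \<Longrightarrow> D a b < c \<Longrightarrow> \<exists>e>0. \<forall>a' b' t.
      \<bar>a' - a\<bar> < e \<longrightarrow> \<bar>b' - b\<bar> < e \<longrightarrow> 0 < t \<longrightarrow> t < e \<longrightarrow> p (a' + t * b') \<le> p a' + t * c"
  shows "((\<lambda>t. ereal (((SUP y. p (f y + t * g y)) - K) / t)) \<longlongrightarrow>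
    (MAX v\<in>quadrants. SUP x\<in>M_plus v (\<lambda>y. p (f y)). ereal (D (vlim v f x) (vlim v g x))))
    (at_right 0)"
    (is "((\<lambda>t. ereal (?q t)) \<longlongrightarrow> ?L) _")
proof -
  obtain a0 where a0: "\<And>x. \<bar>f x\<bar> \<le> a0"
    using f by (auto simp: skorohod_def mspace_linf_iff)
  obtain b0 where b0: "\<And>x. \<bar>g x\<bar> \<le> b0"
    using g by (auto simp: skorohod_def mspace_linf_iff)
  have b0': "b0 \<ge> 0" using b0[of undefined] by linarith
  have bdd: "bdd_above (range (\<lambda>y. p (f y + t * g y)))" for t
  proof (rule bdd_aboveI2)
    fix y
    have "\<bar>t * g y\<bar> \<le> \<bar>t\<bar> * b0" using b0[of y] by (simp add: abs_mult mult_left_mono)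
    then show "p (f y + t * g y) \<le> p 0 + (a0 + \<bar>t\<bar> * b0)"
      using lip[of "f y + t * g y" 0] a0[of y] by linarith
  qed
  have K: "p (f y) \<le> K" for y
    unfolding K_def using bdd[of 0] by (intro cSUP_upper) auto
  have cont: "isCont p a" for a
    unfolding isCont_def
  proof (rule tendsto_sandwich[where f="\<lambda>x. p a - \<bar>x - a\<bar>" and h="\<lambda>x. p a + \<bar>x - a\<bar>"])
    show "\<forall>\<^sub>F x in at a. p a - \<bar>x - a\<bar> \<le> p x" "\<forall>\<^sub>F x in at a. p x \<le> p a + \<bar>x - a\<bar>"
      using lip by (auto intro!: always_eventually simp: abs_le_iff algebra_simps)
    show "((\<lambda>x. p a - \<bar>x - a\<bar>) \<longlongrightarrow> p a) (at a)" "((\<lambda>x. p a + \<bar>x - a\<bar>) \<longlongrightarrow> p a) (at a)"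
      by (auto intro!: tendsto_eq_intros)
  qed
  have pf: "((\<lambda>y. p (f y + t * g y)) \<longlongrightarrow> p (vlim v f x + t * vlim v g x)) (at x within quadrant v x)"
    if "v \<in> quadrants" "quadrant v x \<noteq> {}" for v x t
    by (intro isCont_tendsto_compose[OF cont] tendsto_intros skorohod_tendsto_vlim f g that)
  \<comment> \<open>Continuity of \<open>p\<close> lets it commute with quadrant limits, so
    membership depends on the limits of \<open>f\<close> alone.\<close>
  have M_plus: "x \<in> M_plus v (\<lambda>y. p (f y)) \<longleftrightarrow> quadrant v x \<noteq> {} \<and> p (vlim v f x) = K"
    if "v \<in> quadrants" for v x
  proof (cases "quadrant v x = {}")
    case False
    have "vlim v (\<lambda>y. p (f y)) x = p (vlim v f x)"
      using pf[OF that False, of 0] False by (intro vlim_tendstoI) auto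
    then show ?thesis by (auto simp: M_plus_def K_def)
  qed (simp add: M_plus_def)
  have L: "?L = (SUP v\<in>quadrants. SUP x\<in>M_plus v (\<lambda>y. p (f y)). ereal (D (vlim v f x) (vlim v g x)))"
    by (rule Max_ereal_eq_SUP)
  show ?thesis
  proof (rule order_tendstoI)
    \<comment> \<open>Lower half: some maximal quadrant limit has derivative above \<open>a\<close>.
      The perturbed supremum dominates the limit value there, and \<open>lower\<close> bounds the
      quotient from below for every positive \<open>t\<close>.\<close>
    fix a assume "a < ?L"
    then obtain v x where v: "v \<in> quadrants" and x: "x \<in> M_plus v (\<lambda>y. p (f y))"
      and a: "a < ereal (D (vlim v f x) (vlim v g x))"
      unfolding L less_SUP_iff by auto
    have xq: "quadrant v x \<noteq> {}" "p (vlim v f x) = K" using x M_plus[OF v] by auto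
    have "D (vlim v f x) (vlim v g x) \<le> ?q t" if t: "t > 0" for t
    proof -
      have "p (vlim v f x + t * vlim v g x) \<le> (SUP y. p (f y + t * g y))"
        by (rule tendsto_upperbound[OF pf[OF v xq(1)] always_eventually at_within_quadrant_neq_bot])
          (auto intro!: cSUP_upper bdd xq)
      then show ?thesis
        using lower[OF t, of "vlim v f x" "vlim v g x"] t xq(2) by (simp add: field_simps)
    qed
    then have "\<forall>\<^sub>F t in at_right 0. D (vlim v f x) (vlim v g x) \<le> ?q t"
      by (rule eventually_mono[OF eventually_at_right_less])
    then show "\<forall>\<^sub>F t in at_right 0. a < ereal (?q t)"
    proof eventually_elim
      case (elim t)
      then have "ereal (D (vlim v f x) (vlim v g x)) \<le> ereal (?q t)" by simp
      with a show ?case by (rule less_le_trans)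
    qed
  next
    fix a assume "?L < a"
    then obtain c where c: "?L < ereal c" "ereal c < a"
      using ereal_dense2 by blast
    \<comment> \<open>Upper half: the bound \<open>K + t * c\<close>, uniform over all points for
      small \<open>t\<close>, is enough. By compactness it has to be checked only inside
      quadrants.\<close>
    have "\<exists>t0>0. \<forall>t y. 0 < t \<longrightarrow> t < t0 \<longrightarrow> p (f y + t * g y) \<le> K + t * c"
    proof (rule eventually_quadrants_imp_uniform)
      fix x t
      assume ev: "\<forall>\<^sub>F y in at x within quadrant (upper_dir x) x. p (f y + t * g y) \<le> K + t * c"
      have "((\<lambda>y. p (f y + t * g y)) \<longlongrightarrow> p (f x + t * g x)) (at x within quadrant (upper_dir x) x)"
        by (intro isCont_tendsto_compose[OF cont] tendsto_intros skorohod_tendsto_upper f g)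
      then show "p (f x + t * g x) \<le> K + t * c"
        using ev by (rule tendsto_upperbound)
          (intro at_within_quadrant_neq_bot quadrant_upper_dir_nonempty)
    next
      fix x and v :: "int ^ 'd" assume v: "v \<in> quadrants" and xq: "quadrant v x \<noteq> {}"
      let ?F = "at x within quadrant v x"
      show "\<exists>t0>0. \<forall>\<^sub>F y in ?F. \<forall>t. 0 < t \<longrightarrow> t < t0 \<longrightarrow> p (f y + t * g y) \<le> K + t * c"
      proof (cases "p (vlim v f x) = K")
        \<comment> \<open>The limit is maximal, so its derivative is at most \<open>?L\<close> and
          hence below \<open>c\<close>. Then \<open>upper\<close> compares the perturbed value with
          \<open>p (f y)\<close>, which is at most \<open>K\<close>.\<close>
        case True
        then have "ereal (D (vlim v f x) (vlim v g x)) \<le> ?L"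
          unfolding L using v xq M_plus[OF v] by (intro SUP_upper2[OF v] SUP_upper) auto
        then have "ereal (D (vlim v f x) (vlim v g x)) < ereal c"
          using c(1) by (rule le_less_trans)
        then have "D (vlim v f x) (vlim v g x) < c" by simp
        from upper[OF True this] obtain e where e: "e > 0" "\<forall>a' b' t. \<bar>a' - vlim v f x\<bar> < e \<longrightarrow>
            \<bar>b' - vlim v g x\<bar> < e \<longrightarrow> 0 < t \<longrightarrow> t < e \<longrightarrow> p (a' + t * b') \<le> p a' + t * c"
          by auto
        have "\<forall>\<^sub>F y in ?F. dist (f y) (vlim v f x) < e" "\<forall>\<^sub>F y in ?F. dist (g y) (vlim v g x) < e"
          using skorohod_tendsto_vlim[OF f v xq] skorohod_tendsto_vlim[OF g v xq] e(1)
          by (auto intro: tendstoD)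
        then have "\<forall>\<^sub>F y in ?F. \<forall>t. 0 < t \<longrightarrow> t < e \<longrightarrow> p (f y + t * g y) \<le> K + t * c"
        proof (eventually_elim, intro allI impI)
          fix y t assume "dist (f y) (vlim v f x) < e" "dist (g y) (vlim v g x) < e" "0 < t" "t < e"
          then have "p (f y + t * g y) \<le> p (f y) + t * c"
            using e(2) by (simp add: dist_real_def)
          then show "p (f y + t * g y) \<le> K + t * c" using K[of y] by linarith
        qed
        then show ?thesis using e(1) by blast
      next
        case False
        have lim: "((\<lambda>y. p (f y)) \<longlongrightarrow> p (vlim v f x)) ?F"
          using pf[OF v xq, of 0] by simp
        have "p (vlim v f x) \<le> K"
          by (rule tendsto_upperbound[OF lim always_eventually at_within_quadrant_neq_bot[OF xq]])
            (simp add: K)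
        with False have less: "p (vlim v f x) < K" by simp
        \<comment> \<open>Half of the gap below \<open>K\<close> serves as slack. For
          \<open>t\<close> under the threshold used below, the perturbation \<open>t * g y\<close>
          and a possibly negative \<open>t * c\<close> together cost less than \<open>s\<close>; the
          added 1 keeps the denominator positive.\<close>
        define s where "s = (K - p (vlim v f x)) / 2"
        have s: "s > 0" "p (vlim v f x) < K - s" unfolding s_def using less by (auto simp: field_simps)
        have "\<forall>\<^sub>F y in ?F. p (f y) < K - s"
          using order_tendstoD(2)[OF lim s(2)] .
        then have "\<forall>\<^sub>F y in ?F. \<forall>t. 0 < t \<longrightarrow> t < s / (b0 + \<bar>c\<bar> + 1) \<longrightarrow>
            p (f y + t * g y) \<le> K + t * c"
        proof (eventually_elim, intro allI impI)
          fix y t assume y: "p (f y) < K - s" and t: "0 < t" "t < s / (b0 + \<bar>c\<bar> + 1)"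
          have "t * (b0 + \<bar>c\<bar> + 1) < s" using t b0' by (simp add: pos_less_divide_eq)
          moreover have "\<bar>t * g y\<bar> \<le> t * b0" using b0[of y] t by (simp add: abs_mult)
          moreover have "t * c \<ge> - (t * \<bar>c\<bar>)" using t by (simp add: abs_if)
          moreover have "p (f y + t * g y) \<le> p (f y) + \<bar>t * g y\<bar>"
            using lip[of "f y + t * g y" "f y"] by auto
          ultimately show "p (f y + t * g y) \<le> K + t * c"
            using y t by (simp add: algebra_simps)
        qed
        moreover have "s / (b0 + \<bar>c\<bar> + 1) > 0" using s b0' by simp
        ultimately show ?thesis by blast
      qed
    qed
    then obtain t0 where t0: "t0 > 0"
        "\<forall>t y. 0 < t \<longrightarrow> t < t0 \<longrightarrow> p (f y + t * g y) \<le> K + t * c"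
      by auto
    have "?q t \<le> c" if t: "0 < t" "t < t0" for t
    proof -
      have "(SUP y. p (f y + t * g y)) \<le> K + t * c"
        using t0(2) t by (intro cSUP_least) auto
      then show ?thesis using t by (simp add: field_simps)
    qed
    then have "\<forall>\<^sub>F t in at_right 0. ?q t \<le> c"
      using t0(1) unfolding eventually_at_right_field by auto
    then show "\<forall>\<^sub>F t in at_right 0. ereal (?q t) < a"
    proof eventually_elim
      case (elim t)
      then have "ereal (?q t) \<le> ereal c" by simp
      then show ?case using c(2) by (rule le_less_trans)
    qed
  qed
qed

section \<open>Outer expectations and the bridge paths\<close>

text \<open>A majorant of the larger function is one of the smaller. The bounds \<open>a\<close> and
  \<open>b\<close> make the sets of integrals bounded below and nonempty, without which the real
  infimum need not be monotone.\<close>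

lemma outer_expectation_mono:
  assumes "prob_space M"
    and le: "\<And>\<omega>. \<omega> \<in> space M \<Longrightarrow> T \<omega> \<le> T' \<omega>"
    and lo: "\<And>\<omega>. \<omega> \<in> space M \<Longrightarrow> a \<le> T \<omega>"
    and up: "\<And>\<omega>. \<omega> \<in> space M \<Longrightarrow> T' \<omega> \<le> b"
  shows "outer_expectation M T \<le> outer_expectation M T'"
  unfolding outer_expectation_def
proof (rule cInf_superset_mono)
  interpret prob_space M by fact
  have "integrable M (\<lambda>_. b) \<and> (\<forall>\<omega>\<in>space M. T' \<omega> \<le> b)" using up by simp
  then show "{integral\<^sup>L M U |U. integrable M U \<and> (\<forall>\<omega>\<in>space M. T' \<omega> \<le> U \<omega>)} \<noteq> {}"
    by blast
  show "bdd_below {integral\<^sup>L M U |U. integrable M U \<and> (\<forall>\<omega>\<in>space M. T \<omega> \<le> U \<omega>)}"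
  proof (rule bdd_belowI[of _ a], clarify)
    fix U assume U: "integrable M U" "\<forall>\<omega>\<in>space M. T \<omega> \<le> U \<omega>"
    have "a \<le> U \<omega>" if "\<omega> \<in> space M" for \<omega>
      using lo[OF that] U(2) that by (meson order.trans)
    then have "integral\<^sup>L M (\<lambda>_. a) \<le> integral\<^sup>L M U"
      using U(1) by (intro integral_mono) auto
    then show "a \<le> integral\<^sup>L M U" by (simp add: prob_space)
  qed
  show "{integral\<^sup>L M U |U. integrable M U \<and> (\<forall>\<omega>\<in>space M. T' \<omega> \<le> U \<omega>)} \<subseteq>
      {integral\<^sup>L M U |U. integrable M U \<and> (\<forall>\<omega>\<in>space M. T \<omega> \<le> U \<omega>)}"
  proof (intro subsetI, elim CollectE exE conjE)
    fix z U assume U: "z = integral\<^sup>L M U" "integrable M U" "\<forall>\<omega>\<in>space M. T' \<omega> \<le> U \<omega>"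
    have "T \<omega> \<le> U \<omega>" if "\<omega> \<in> space M" for \<omega>
      using le[OF that] U(3) that by (meson order.trans)
    then show "z \<in> {integral\<^sup>L M U |U. integrable M U \<and> (\<forall>\<omega>\<in>space M. T \<omega> \<le> U \<omega>)}"
      using U by auto
  qed
qed

text \<open>An integrable function is its own smallest majorant. This turns outer expectations into
  integrals wherever measurability is known.\<close>

lemma outer_expectation_eq_integral:
  assumes "integrable M T"
  shows "outer_expectation M T = integral\<^sup>L M T"
  unfolding outer_expectation_def
proof (rule cInf_eq_minimum)
  show "integral\<^sup>L M T \<in> {integral\<^sup>L M U |U. integrable M U \<and> (\<forall>\<omega>\<in>space M. T \<omega> \<le> U \<omega>)}"
    using assms by auto
  show "integral\<^sup>L M T \<le> z"
    if "z \<in> {integral\<^sup>L M U |U. integrable M U \<and> (\<forall>\<omega>\<in>space M. T \<omega> \<le> U \<omega>)}" for z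
    using that assms by (auto intro!: integral_mono)
qed

lemma continuous_map_linf_if_lipschitz:
  assumes "\<And>f g. f \<in> mspace linf \<Longrightarrow> g \<in> mspace linf \<Longrightarrow> \<bar>H f - H g\<bar> \<le> C * mdist linf f g"
  shows "continuous_map (mtopology_of linf) euclideanreal H"
proof -
  have "Lipschitz_continuous_map linf euclidean_metric H"
    using assms by (auto simp: Lipschitz_continuous_map_def dist_real_def)
  then show ?thesis
    using Lipschitz_continuous_imp_continuous_map by fastforce
qed

lemma
  assumes "B \<in> N \<rightarrow>\<^sub>M sigma (mspace E) {U. openin (mtopology_of E) U}"
  shows weak_limit_in_mspace: "\<omega> \<in> space N \<Longrightarrow> B \<omega> \<in> mspace E"
    and borel_measurable_continuous_map_weak_limit:
      "continuous_map (mtopology_of E) euclideanreal H \<Longrightarrow> (\<lambda>\<omega>. H (B \<omega>)) \<in> borel_measurable N"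
proof -
  have sub: "{U. openin (mtopology_of E) U} \<subseteq> Pow (mspace E)"
    using openin_subset by force
  have sp: "space (sigma (mspace E) {U. openin (mtopology_of E) U}) = mspace E"
    by (rule space_measure_of[OF sub])
  show "\<omega> \<in> space N \<Longrightarrow> B \<omega> \<in> mspace E"
    using measurable_space[OF assms] sp by simp
  assume H: "continuous_map (mtopology_of E) euclideanreal H"
  have "H \<in> borel_measurable (sigma (mspace E) {U. openin (mtopology_of E) U})"
  proof (rule borel_measurableI)
    fix S :: "real set" assume "open S"
    then have "openin (mtopology_of E) {x \<in> topspace (mtopology_of E). H x \<in> S}"
      using openin_continuous_map_preimage[OF H] by simp
    moreover have "{x \<in> topspace (mtopology_of E). H x \<in> S} = H -` S \<inter> mspace E" by auto
    ultimately show "H -` S \<inter> space (sigma (mspace E) {U. openin (mtopology_of E) U}) \<in>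
        sets (sigma (mspace E) {U. openin (mtopology_of E) U})"
      unfolding sp using sub by (simp add: sets_measure_of sigma_sets.Basic)
  qed
  then show "(\<lambda>\<omega>. H (B \<omega>)) \<in> borel_measurable N"
    by (rule measurable_compose[OF assms])
qed

section \<open>Closedness of the Skorohod space and the paths of weak limits\<close>

lemma skorohod_subset_linf: "f \<in> skorohod \<Longrightarrow> f \<in> mspace linf"
  by (simp add: skorohod_def)

lemma zero_skorohod: "(\<lambda>_. 0) \<in> skorohod"
  by (rule skorohodI) (auto simp: mspace_linf_iff)

text \<open>Uniform convergence allows limits to be interchanged. Continuity from above passes on
  directly; for the other quadrants the limits of the approximants are first shown to be Cauchy,
  being no farther apart than the uniform bound on the approximants.\<close>

lemma skorohod_closed:
  fixes f :: "ereal ^ 'd \<Rightarrow> real"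
  assumes f: "f \<in> mspace linf"
    and approx: "\<And>e. e > 0 \<Longrightarrow> \<exists>g\<in>skorohod. mdist linf f g < e"
  shows "f \<in> skorohod"
proof -
  have "\<exists>g\<in>skorohod. mdist linf f g < inverse (real (Suc n))" for n
    by (rule approx) simp
  then obtain g where g: "\<And>n. g n \<in> skorohod" "\<And>n. mdist linf f (g n) < inverse (real (Suc n))"
    by metis
  have near: "\<bar>f x - g n x\<bar> < inverse (real (Suc n))" for n x
    using abs_diff_le_mdist_linf[OF f skorohod_subset_linf[OF g(1)[of n]], of x] g(2)[of n]
    by linarith
  have unif: "uniform_limit UNIV g f sequentially"
  proof (rule uniform_limitI)
    fix e :: real assume "e > 0"
    then have "\<forall>\<^sub>F n in sequentially. inverse (real (Suc n)) < e"
      by (rule Archimedean_eventually_inverse[THEN iffD2])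
    then show "\<forall>\<^sub>F n in sequentially. \<forall>x\<in>UNIV. dist (g n x) (f x) < e"
    proof eventually_elim
      case (elim n)
      show ?case
        using near[of _ n] elim by (auto simp: dist_real_def abs_minus_commute intro: less_trans)
    qed
  qed
  show ?thesis
  proof (rule skorohodI[OF f])
    fix x
    show "(f \<longlongrightarrow> f x) (at x within quadrant (upper_dir x) x)"
      by (rule swap_uniform_limit'[OF _ _ unif])
        (auto intro!: always_eventually skorohod_tendsto_upper g tendsto_uniform_limitI[OF unif])
  next
    fix x and v :: "int ^ 'd" assume v: "v \<in> quadrants" "quadrant v x \<noteq> {}"
    let ?F = "at x within quadrant v x"
    have lim: "(g n \<longlongrightarrow> vlim v (g n) x) ?F" for n
      by (intro skorohod_tendsto_vlim g v)
    have diff: "\<bar>vlim v (g n) x - vlim v (g m) x\<bar> \<le> inverse (real (Suc n)) + inverse (real (Suc m))" for n m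
    proof (rule tendsto_upperbound)
      show "((\<lambda>y. \<bar>g n y - g m y\<bar>) \<longlongrightarrow> \<bar>vlim v (g n) x - vlim v (g m) x\<bar>) ?F"
        by (intro tendsto_intros lim)
      have "\<bar>g n y - g m y\<bar> \<le> inverse (real (Suc n)) + inverse (real (Suc m))" for y
        using near[of y n] near[of y m] by linarith
      then show "\<forall>\<^sub>F y in ?F. \<bar>g n y - g m y\<bar> \<le> inverse (real (Suc n)) + inverse (real (Suc m))"
        by (simp add: always_eventually)
      show "?F \<noteq> bot" by (rule at_within_quadrant_neq_bot[OF v(2)])
    qed
    have "Cauchy (\<lambda>n. vlim v (g n) x)"
    proof (rule metric_CauchyI)
      fix e :: real assume "e > 0"
      then obtain k where k: "inverse (real (Suc k)) < e / 2"
        using reals_Archimedean[of "e / 2"] by auto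
      have small: "inverse (real (Suc n)) < e / 2" if "n \<ge> k" for n
      proof -
        have "inverse (real (Suc n)) \<le> inverse (real (Suc k))"
          using that by (intro le_imp_inverse_le) auto
        then show ?thesis using k by linarith
      qed
      have "dist (vlim v (g m) x) (vlim v (g n) x) < e" if "m \<ge> k" "n \<ge> k" for m n
        using diff[of m n] small[OF that(1)] small[OF that(2)] by (simp add: dist_real_def)
      then show "\<exists>M. \<forall>m\<ge>M. \<forall>n\<ge>M. dist (vlim v (g m) x) (vlim v (g n) x) < e" by blast
    qed
    then obtain l where l: "(\<lambda>n. vlim v (g n) x) \<longlonglongrightarrow> l"
      using Cauchy_convergent_iff convergentD by blast
    have "(f \<longlongrightarrow> l) ?F"
      by (rule swap_uniform_limit'[OF _ l unif]) (use lim in auto)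
    then show "\<exists>l. (f \<longlongrightarrow> l) ?F" by blast
  qed
qed

text \<open>The test function is the truncated distance to the closed set \<^term>\<open>skorohod\<close>.\<close>

lemma weak_limit_AE_skorohod:
  fixes B :: "'e \<Rightarrow> ereal ^ 'd \<Rightarrow> real"
  assumes P: "prob_space P" and N: "prob_space N"
    and conv: "converges_weakly linf P W N B"
    and W: "\<And>n s. s \<in> space P \<Longrightarrow> W n s \<in> skorohod"
  shows "AE \<omega> in N. B \<omega> \<in> skorohod"
proof -
  interpret P: prob_space P by fact
  interpret N: prob_space N by fact
  define d where "d f = (INF g\<in>skorohod. mdist linf f g)" for f :: "ereal ^ 'd \<Rightarrow> real"
  define H where "H f = min 1 (d f)" for f
  have bdd: "bdd_below ((\<lambda>g. mdist linf f g) ` skorohod)" for f :: "ereal ^ 'd \<Rightarrow> real"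
    by (rule bdd_belowI2[of _ 0]) simp
  have ne: "(skorohod :: (ereal ^ 'd \<Rightarrow> real) set) \<noteq> {}"
    using zero_skorohod by blast
  have d0: "d f \<ge> 0" for f
    unfolding d_def by (rule cINF_greatest[OF ne]) simp
  \<comment> \<open>The triangle inequality makes the distance 1-Lipschitz; with the truncation at
    1, \<open>H\<close> is a bounded continuous test function.\<close>
  have tri: "d f \<le> mdist linf f h + d h" if "f \<in> mspace linf" "h \<in> mspace linf" for f h
  proof -
    have "d f - mdist linf f h \<le> d h"
      unfolding d_def[of h]
    proof (rule cINF_greatest[OF ne])
      fix g :: "ereal ^ 'd \<Rightarrow> real" assume g: "g \<in> skorohod"
      have "d f \<le> mdist linf f g" unfolding d_def by (rule cINF_lower[OF bdd g])
      also have "\<dots> \<le> mdist linf f h + mdist linf h g"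
        using that skorohod_subset_linf[OF g] by (intro mdist_triangle)
      finally show "d f - mdist linf f h \<le> mdist linf h g" by simp
    qed
    then show ?thesis by simp
  qed
  have contH: "continuous_map (mtopology_of linf) euclideanreal H"
  proof (rule continuous_map_linf_if_lipschitz[of _ 1])
    fix f g :: "ereal ^ 'd \<Rightarrow> real" assume fg: "f \<in> mspace linf" "g \<in> mspace linf"
    have "mdist linf f g = mdist linf g f" by (rule mdist_commute)
    then show "\<bar>H f - H g\<bar> \<le> 1 * mdist linf f g"
      using tri[OF fg] tri[OF fg(2,1)] unfolding H_def by linarith
  qed
  have H01: "0 \<le> H f" "H f \<le> 1" for f using d0[of f] by (auto simp: H_def)
  have Hsk: "H f = 0" if "f \<in> skorohod" for f
  proof -
    have "mdist linf f f = 0" using skorohod_subset_linf[OF that] by simp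
    moreover have "d f \<le> mdist linf f f" unfolding d_def by (rule cINF_lower[OF bdd that])
    ultimately show ?thesis using d0[of f] by (simp add: H_def)
  qed
  have B: "B \<in> N \<rightarrow>\<^sub>M sigma (mspace linf) {U. openin (mtopology_of linf) U}"
    using conv by (simp add: converges_weakly_def)
  have meas: "(\<lambda>\<omega>. H (B \<omega>)) \<in> borel_measurable N"
    by (rule borel_measurable_continuous_map_weak_limit[OF B contH])
  have "bounded (H ` mspace linf)"
    using H01 by (intro boundedI[of _ 1]) auto
  then have "(\<lambda>n. outer_expectation P (\<lambda>s. H (W n s))) \<longlonglongrightarrow> (\<integral>\<omega>. H (B \<omega>) \<partial>N)"
    using conv contH unfolding converges_weakly_def by simp
  \<comment> \<open>Every path of \<open>W\<close> lies in the Skorohod space, where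
    \<open>H\<close> vanishes, so no question of measurability arises.\<close>
  moreover have "outer_expectation P (\<lambda>s. H (W n s)) = 0" for n
  proof -
    have "integrable P (\<lambda>s. H (W n s)) \<longleftrightarrow> integrable P (\<lambda>s. 0 :: real)"
      by (rule Bochner_Integration.integrable_cong) (auto simp: Hsk W)
    then have "outer_expectation P (\<lambda>s. H (W n s)) = (\<integral>s. H (W n s) \<partial>P)"
      by (intro outer_expectation_eq_integral) simp
    also have "\<dots> = (\<integral>s. 0 \<partial>P)"
      by (rule Bochner_Integration.integral_cong) (auto simp: Hsk W)
    finally show ?thesis by simp
  qed
  ultimately have "(\<integral>\<omega>. H (B \<omega>) \<partial>N) = 0"
    by (simp add: LIMSEQ_const_iff)
  moreover have "integrable N (\<lambda>\<omega>. H (B \<omega>))"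
    using H01 by (intro N.integrable_const_bound[of _ 1] meas) auto
  ultimately have "AE \<omega> in N. H (B \<omega>) = 0"
    using integral_nonneg_eq_0_iff_AE[of N "\<lambda>\<omega>. H (B \<omega>)"] H01 by auto
  moreover have "AE \<omega> in N. B \<omega> \<in> mspace linf"
    using weak_limit_in_mspace[OF B] by (rule AE_I2)
  ultimately show ?thesis
  proof eventually_elim
    case (elim \<omega>)
    show ?case
    proof (rule skorohod_closed)
      \<comment> \<open>Truncation at 1 creates no new zeros, so \<open>H (B \<omega>) = 0\<close>
        means distance zero.\<close>
      fix e :: real assume "e > 0"
      then have "(INF g\<in>skorohod. mdist linf (B \<omega>) g) < e"
        using elim d0[of "B \<omega>"] by (simp add: H_def d_def min_def split: if_splits)
      then show "\<exists>g\<in>skorohod. mdist linf (B \<omega>) g < e"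
        using cINF_less_iff[OF ne bdd] by blast
    qed (use elim in auto)
  qed
qed

section \<open>The delta method for convex functionals\<close>

text \<open>The difference quotient of \<open>\<phi>\<close> at \<open>f\<close> in direction
  \<open>h\<close> with step \<open>1 / sqrt (real n)\<close>. Written as a product it is 0 at
  \<open>n = 0\<close>.\<close>

definition scaled_diff ::
    "((ereal ^ 'd \<Rightarrow> real) \<Rightarrow> real) \<Rightarrow> (ereal ^ 'd \<Rightarrow> real) \<Rightarrow> nat \<Rightarrow> (ereal ^ 'd \<Rightarrow> real) \<Rightarrow> real" where
  "scaled_diff \<phi> f n h = sqrt (real n) * (\<phi> (\<lambda>x. f x + h x / sqrt (real n)) - \<phi> f)"

text \<open>Used on all bounded functions, unlike the stated derivatives, so that it can be a
  continuous test functional on the whole of \<open>linf\<close>.\<close>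

definition dir_deriv ::
    "((ereal ^ 'd \<Rightarrow> real) \<Rightarrow> real) \<Rightarrow> (ereal ^ 'd \<Rightarrow> real) \<Rightarrow> (ereal ^ 'd \<Rightarrow> real) \<Rightarrow> real" where
  "dir_deriv \<phi> f h = lim (\<lambda>n. scaled_diff \<phi> f n h)"

text \<open>Integrals of the functions \<open>cts_step a b\<close> determine weak convergence on the
  real line. Their monotonicity turns the sandwich of quotients into inequalities between
  expectations.\<close>

lemma cts_step_antimono:
  assumes "a < b" "x \<le> y"
  shows "cts_step a b y \<le> cts_step a b x"
  using assms by (auto simp: cts_step_def divide_right_mono)

lemma cts_step_bounds:
  assumes "a < b"
  shows "0 \<le> cts_step a b x" "cts_step a b x \<le> 1"
  using assms by (auto simp: cts_step_def)

lemma continuous_on_cts_step: "a < b \<Longrightarrow> continuous_on UNIV (cts_step a b)"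
  by (intro uniformly_continuous_imp_continuous cts_step_uniformly_continuous)

text \<open>Preimages under the two functions differ by subsets of null sets, which the completion
  contains. This handles derivatives that are unspecified off the Skorohod space.\<close>

lemma measurable_completion_AE_cong:
  assumes f: "f \<in> M \<rightarrow>\<^sub>M borel" and ae: "AE x in M. f x = g x"
  shows "g \<in> borel_measurable (completion M)"
proof (rule borel_measurableI)
  fix S :: "'b set" assume "open S"
  then have A: "f -` S \<inter> space (completion M) \<in> sets (completion M)"
    using measurable_sets[OF measurable_completion[OF f]] by simp
  show "g -` S \<inter> space (completion M) \<in> sets (completion M)"
  proof (rule completion.in_sets_AE[OF _ A])
    have "AE x in completion M. f x = g x" by (rule AE_completion[OF ae])
    then show "AE x in completion M. (x \<in> f -` S \<inter> space (completion M)) =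
        (x \<in> g -` S \<inter> space (completion M))"
      by eventually_elim auto
  qed auto
qed

text \<open>Convexity makes the difference quotients monotone; the Lipschitz bound keeps them
  bounded below and makes both the quotients and their limit continuous.\<close>

locale convex_lipschitz =
  fixes \<phi> :: "(ereal ^ 'd \<Rightarrow> real) \<Rightarrow> real" and C :: real
  assumes convex: "\<lbrakk>f \<in> mspace linf; g \<in> mspace linf; 0 \<le> u; u \<le> 1\<rbrakk> \<Longrightarrow>
      \<phi> (\<lambda>x. (1 - u) * f x + u * g x) \<le> (1 - u) * \<phi> f + u * \<phi> g"
    and lipschitz: "\<lbrakk>f \<in> mspace linf; g \<in> mspace linf\<rbrakk> \<Longrightarrow> \<bar>\<phi> f - \<phi> g\<bar> \<le> C * mdist linf f g"
    and C_nonneg: "0 \<le> C"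
begin

lemma mspace_linf_perturbed:
  "\<lbrakk>f \<in> mspace linf; h \<in> mspace linf\<rbrakk> \<Longrightarrow> (\<lambda>x. f x + h x / sqrt (real n)) \<in> mspace linf"
  using mspace_linf_add_scaled[of f h "1 / sqrt (real n)"] by simp

text \<open>The outer factor \<open>sqrt (real n)\<close> cancels the step size, so the constant
  does not depend on \<open>n\<close>.\<close>

lemma scaled_diff_lipschitz:
  assumes f: "f \<in> mspace linf" and h: "h \<in> mspace linf" "k \<in> mspace linf"
  shows "\<bar>scaled_diff \<phi> f n h - scaled_diff \<phi> f n k\<bar> \<le> C * mdist linf h k"
proof (cases "n = 0")
  case True
  then show ?thesis using C_nonneg by (simp add: scaled_diff_def)
next
  case False
  let ?s = "sqrt (real n)"
  have s: "?s > 0" using False by simp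
  have "\<bar>h x - k x\<bar> / ?s \<le> mdist linf h k / ?s" for x
    using abs_diff_le_mdist_linf[OF h] s by (intro divide_right_mono) auto
  then have d: "mdist linf (\<lambda>x. f x + h x / ?s) (\<lambda>x. f x + k x / ?s) \<le> mdist linf h k / ?s"
    using s by (intro mdist_linf_le mspace_linf_perturbed f h) (simp add: abs_divide flip: diff_divide_distrib)
  have "\<bar>scaled_diff \<phi> f n h - scaled_diff \<phi> f n k\<bar> =
      ?s * \<bar>\<phi> (\<lambda>x. f x + h x / ?s) - \<phi> (\<lambda>x. f x + k x / ?s)\<bar>"
    using s by (simp add: scaled_diff_def abs_mult flip: right_diff_distrib)
  also have "\<dots> \<le> ?s * (C * (mdist linf h k / ?s))"
    using lipschitz[OF mspace_linf_perturbed[OF f h(1)] mspace_linf_perturbed[OF f h(2)], of n n]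
      mult_left_mono[OF d C_nonneg] s
    by (intro mult_left_mono) (auto intro: order.trans)
  finally show ?thesis using s by simp
qed

text \<open>The perturbed function with index \<open>n\<close> is the convex combination of
  \<open>f\<close> and the one with index \<open>m\<close>, the latter with weight
  \<open>u = sqrt (real m) / sqrt (real n)\<close>.\<close>

lemma scaled_diff_antimono:
  assumes f: "f \<in> mspace linf" and h: "h \<in> mspace linf" and m: "0 < m" "m \<le> n"
  shows "scaled_diff \<phi> f n h \<le> scaled_diff \<phi> f m h"
proof -
  let ?s = "\<lambda>n. sqrt (real n)"
  define u where "u = ?s m / ?s n"
  have s: "?s m > 0" "?s n > 0" "?s m \<le> ?s n" using m by auto
  have u: "0 \<le> u" "u \<le> 1" unfolding u_def using s by auto
  have "(\<lambda>x. f x + h x / ?s n) = (\<lambda>x. (1 - u) * f x + u * (f x + h x / ?s m))"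
    unfolding u_def using s by (auto simp: field_simps)
  then have "\<phi> (\<lambda>x. f x + h x / ?s n) - \<phi> f \<le> u * (\<phi> (\<lambda>x. f x + h x / ?s m) - \<phi> f)"
    using convex[OF f mspace_linf_perturbed[OF f h] u, of m] by (simp add: algebra_simps)
  then have "scaled_diff \<phi> f n h \<le> ?s n * (u * (\<phi> (\<lambda>x. f x + h x / ?s m) - \<phi> f))"
    unfolding scaled_diff_def using s by (intro mult_left_mono) auto
  also have "\<dots> = scaled_diff \<phi> f m h"
    unfolding scaled_diff_def u_def using s by simp
  finally show ?thesis .
qed

text \<open>A decreasing sequence bounded below converges. The lower bound compares \<open>h\<close>
  with the zero direction, where the quotient vanishes.\<close>

lemma scaled_diff_tendsto:
  assumes f: "f \<in> mspace linf" and h: "h \<in> mspace linf"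
  shows "(\<lambda>n. scaled_diff \<phi> f n h) \<longlonglongrightarrow> dir_deriv \<phi> f h"
proof -
  have zero: "(\<lambda>_. 0) \<in> mspace linf" by (auto simp: mspace_linf_iff)
  have "\<forall>n. - (C * mdist linf h (\<lambda>_. 0)) \<le> scaled_diff \<phi> f (Suc n) h"
  proof
    fix n
    have "scaled_diff \<phi> f (Suc n) (\<lambda>_. 0) = 0" by (simp add: scaled_diff_def)
    then show "- (C * mdist linf h (\<lambda>_. 0)) \<le> scaled_diff \<phi> f (Suc n) h"
      using scaled_diff_lipschitz[OF f h zero, of "Suc n"] by linarith
  qed
  \<comment> \<open>The shift by one skips the value 0 at \<open>n = 0\<close>, where monotonicity
    may fail.\<close>
  moreover have "decseq (\<lambda>n. scaled_diff \<phi> f (Suc n) h)"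
    unfolding decseq_def using scaled_diff_antimono[OF f h] by simp
  ultimately obtain l where "(\<lambda>n. scaled_diff \<phi> f (Suc n) h) \<longlonglongrightarrow> l"
    using decseq_convergent by blast
  then have "(\<lambda>n. scaled_diff \<phi> f n h) \<longlonglongrightarrow> l" by (rule LIMSEQ_imp_Suc)
  then show ?thesis unfolding dir_deriv_def by (simp add: limI)
qed

lemma dir_deriv_le_scaled_diff:
  assumes "f \<in> mspace linf" "h \<in> mspace linf" "0 < n"
  shows "dir_deriv \<phi> f h \<le> scaled_diff \<phi> f n h"
  by (rule tendsto_upperbound[OF scaled_diff_tendsto[OF assms(1,2)] eventually_sequentiallyI[of n]])
    (use scaled_diff_antimono assms in auto)

lemma continuous_map_scaled_diff:
  assumes "f \<in> mspace linf"
  shows "continuous_map (mtopology_of linf) euclideanreal (scaled_diff \<phi> f n)"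
  by (rule continuous_map_linf_if_lipschitz) (rule scaled_diff_lipschitz[OF assms])

text \<open>A pointwise limit of functions with a common Lipschitz constant keeps that
  constant.\<close>

lemma continuous_map_dir_deriv:
  assumes f: "f \<in> mspace linf"
  shows "continuous_map (mtopology_of linf) euclideanreal (dir_deriv \<phi> f)"
proof (rule continuous_map_linf_if_lipschitz)
  fix h k :: "ereal ^ 'd \<Rightarrow> real" assume h: "h \<in> mspace linf" and k: "k \<in> mspace linf"
  have lim: "(\<lambda>n. \<bar>scaled_diff \<phi> f n h - scaled_diff \<phi> f n k\<bar>) \<longlonglongrightarrow>
      \<bar>dir_deriv \<phi> f h - dir_deriv \<phi> f k\<bar>"
    by (rule tendsto_rabs[OF tendsto_diff[OF scaled_diff_tendsto[OF f h] scaled_diff_tendsto[OF f k]]])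
  show "\<bar>dir_deriv \<phi> f h - dir_deriv \<phi> f k\<bar> \<le> C * mdist linf h k"
    by (rule LIMSEQ_le_const2[OF lim]) (use scaled_diff_lipschitz[OF f h k] in blast)
qed

text \<open>Convexity makes \<^term>\<open>scaled_diff \<phi> f n\<close> decrease to \<^term>\<open>dir_deriv \<phi> f\<close>.  The sandwich
  \<open>dir_deriv \<phi> f (W n) \<le> scaled_diff \<phi> f n (W n) \<le> scaled_diff \<phi> f m (W n)\<close> for \<open>m \<le> n\<close> therefore
  replaces the tightness argument of the general delta method.\<close>

theorem delta_method:
  fixes B :: "'e \<Rightarrow> ereal ^ 'd \<Rightarrow> real"
  assumes P: "prob_space P" and N: "prob_space N"
    and conv: "converges_weakly linf P W N B"
    and f: "f \<in> mspace linf"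
    and meas: "\<And>n. (\<lambda>s. scaled_diff \<phi> f n (W n s)) \<in> borel_measurable P"
    and Z: "AE \<omega> in N. (\<lambda>n. ereal (scaled_diff \<phi> f n (B \<omega>))) \<longlonglongrightarrow> Z \<omega>"
  shows "converges_in_distribution P (\<lambda>n s. scaled_diff \<phi> f n (W n s)) N Z"
proof -
  interpret P: prob_space P by fact
  interpret N: prob_space N by fact
  interpret CN: prob_space "completion N" by (rule N.prob_space_completion)
  let ?d = "scaled_diff \<phi> f" and ?\<Phi> = "dir_deriv \<phi> f"
  have B: "B \<in> N \<rightarrow>\<^sub>M sigma (mspace linf) {U. openin (mtopology_of linf) U}"
    using conv by (simp add: converges_weakly_def)
  have Bl: "B \<omega> \<in> mspace linf" if "\<omega> \<in> space N" for \<omega>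
    using weak_limit_in_mspace[OF B that] .
  have Wl: "W n s \<in> mspace linf" if "s \<in> space P" for n s
    using conv that by (simp add: converges_weakly_def)
  have \<Phi>B [measurable]: "(\<lambda>\<omega>. ?\<Phi> (B \<omega>)) \<in> borel_measurable N"
    by (rule borel_measurable_continuous_map_weak_limit[OF B continuous_map_dir_deriv[OF f]])
  have dB [measurable]: "(\<lambda>\<omega>. ?d n (B \<omega>)) \<in> borel_measurable N" for n
    by (rule borel_measurable_continuous_map_weak_limit[OF B continuous_map_scaled_diff[OF f]])
  have "AE \<omega> in N. B \<omega> \<in> mspace linf" using Bl by (rule AE_I2)
  \<comment> \<open>By uniqueness of limits \<open>Z\<close> agrees almost surely with a measurable
    real functional of the path, whence its measurability on the completion and its
    finiteness.\<close>
  with Z have Z\<Phi>: "AE \<omega> in N. ereal (?\<Phi> (B \<omega>)) = Z \<omega>"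
  proof eventually_elim
    case (elim \<omega>)
    have "(\<lambda>n. ereal (?d n (B \<omega>))) \<longlonglongrightarrow> ereal (?\<Phi> (B \<omega>))"
      using scaled_diff_tendsto[OF f elim(2)] by simp
    then show ?case using elim(1) LIMSEQ_unique by blast
  qed
  have Z_meas: "Z \<in> borel_measurable (completion N)"
    by (rule measurable_completion_AE_cong[OF _ Z\<Phi>]) measurable
  have key: "(\<lambda>n. \<integral>s. cts_step a b (?d n (W n s)) \<partial>P) \<longlonglongrightarrow> (\<integral>\<omega>. cts_step a b (?\<Phi> (B \<omega>)) \<partial>N)"
    if ab: "a < b" for a b
  proof -
    let ?k = "cts_step a b"
    note k01 = cts_step_bounds[OF ab] and k_mono = cts_step_antimono[OF ab]
    have [measurable]: "?k \<in> borel_measurable borel"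
      using continuous_on_cts_step[OF ab] by (rule borel_measurable_continuous_onI)
    have weak: "(\<lambda>n. outer_expectation P (\<lambda>s. ?k (H (W n s)))) \<longlonglongrightarrow> (\<integral>\<omega>. ?k (H (B \<omega>)) \<partial>N)"
      if H: "continuous_map (mtopology_of linf) euclideanreal H" for H
    proof -
      have "continuous_map (mtopology_of linf) euclideanreal (\<lambda>h. ?k (H h))"
        using continuous_map_compose[OF H, of euclideanreal ?k] continuous_on_cts_step[OF ab]
        by (simp add: comp_def)
      moreover have "bounded ((\<lambda>h. ?k (H h)) ` mspace linf)"
        using k01 by (intro boundedI[of _ 1]) auto
      ultimately show ?thesis
        using conv unfolding converges_weakly_def by blast
    qed
    \<comment> \<open>Measurability is assumed for matching indices only;
      \<open>?d m (W n s)\<close> and \<open>?\<Phi> (W n s)\<close> keep their outer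
      expectations.\<close>
    have exact: "outer_expectation P (\<lambda>s. ?k (?d n (W n s))) = (\<integral>s. ?k (?d n (W n s)) \<partial>P)" for n
      by (intro outer_expectation_eq_integral P.integrable_const_bound[of _ 1])
        (use k01 meas in auto)
    have dom: "(\<lambda>m. \<integral>\<omega>. ?k (?d m (B \<omega>)) \<partial>N) \<longlonglongrightarrow> (\<integral>\<omega>. ?k (?\<Phi> (B \<omega>)) \<partial>N)"
    proof (rule integral_dominated_convergence[where w="\<lambda>_. 1"])
      show "AE \<omega> in N. (\<lambda>m. ?k (?d m (B \<omega>))) \<longlonglongrightarrow> ?k (?\<Phi> (B \<omega>))"
        by (rule AE_I2) (auto intro!: continuous_on_tendsto_compose[OF continuous_on_cts_step[OF ab]]
            scaled_diff_tendsto f Bl)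
    qed (use k01 in auto)
    show ?thesis
    proof (rule order_tendstoI)
      \<comment> \<open>First \<open>m\<close> is fixed by dominated convergence, then
        \<open>n\<close> grows with the continuous functional \<open>?d m\<close>. Since
        \<open>?k\<close> is decreasing and \<open>?d n\<close> lies below \<open>?d m\<close>, the
        expectation at \<open>n\<close> is the larger one.\<close>
      fix c assume "c < (\<integral>\<omega>. ?k (?\<Phi> (B \<omega>)) \<partial>N)"
      then have "\<forall>\<^sub>F m in sequentially. c < (\<integral>\<omega>. ?k (?d m (B \<omega>)) \<partial>N)"
        by (rule order_tendstoD[OF dom])
      then have "\<forall>\<^sub>F m in sequentially. 0 < m \<and> c < (\<integral>\<omega>. ?k (?d m (B \<omega>)) \<partial>N)"
        using eventually_gt_at_top[of 0] by eventually_elim simp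
      then obtain m where m: "0 < m" "c < (\<integral>\<omega>. ?k (?d m (B \<omega>)) \<partial>N)"
        by (auto dest: eventually_happens)
      have "\<forall>\<^sub>F n in sequentially. c < outer_expectation P (\<lambda>s. ?k (?d m (W n s)))"
        by (rule order_tendstoD(1)[OF weak[OF continuous_map_scaled_diff[OF f]] m(2)])
      then show "\<forall>\<^sub>F n in sequentially. c < (\<integral>s. ?k (?d n (W n s)) \<partial>P)"
        using eventually_ge_at_top[of m]
      proof eventually_elim
        case (elim n)
        have "outer_expectation P (\<lambda>s. ?k (?d m (W n s))) \<le> outer_expectation P (\<lambda>s. ?k (?d n (W n s)))"
          using k01 elim(2) m(1)
          by (intro outer_expectation_mono[where a=0 and b=1] P k_mono scaled_diff_antimono f Wl) auto
        then show ?case using elim(1) exact[of n] by linarith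
      qed
    next
      \<comment> \<open>The limit functional lies below every quotient, so its
        \<open>?k\<close>-expectation lies above, and no auxiliary index is needed.\<close>
      fix c assume "(\<integral>\<omega>. ?k (?\<Phi> (B \<omega>)) \<partial>N) < c"
      then have "\<forall>\<^sub>F n in sequentially. outer_expectation P (\<lambda>s. ?k (?\<Phi> (W n s))) < c"
        by (rule order_tendstoD(2)[OF weak[OF continuous_map_dir_deriv[OF f]]])
      then show "\<forall>\<^sub>F n in sequentially. (\<integral>s. ?k (?d n (W n s)) \<partial>P) < c"
        using eventually_gt_at_top[of 0]
      proof eventually_elim
        case (elim n)
        have "outer_expectation P (\<lambda>s. ?k (?d n (W n s))) \<le> outer_expectation P (\<lambda>s. ?k (?\<Phi> (W n s)))"
          using k01 elim(2)
          by (intro outer_expectation_mono[where a=0 and b=1] P k_mono dir_deriv_le_scaled_diff f Wl) auto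
        then show ?case using elim(1) exact[of n] by linarith
      qed
    qed
  qed
  have Zr: "(\<lambda>\<omega>. real_of_ereal (Z \<omega>)) \<in> borel_measurable (completion N)"
    using Z_meas by measurable
  have "weak_conv_m (\<lambda>n. distr P borel (\<lambda>s. ?d n (W n s)))
      (distr (completion N) borel (\<lambda>\<omega>. real_of_ereal (Z \<omega>)))"
  proof (rule integral_cts_step_conv_imp_weak_conv)
    show "real_distribution (distr P borel (\<lambda>s. ?d n (W n s)))" for n
      using meas by (rule P.real_distribution_distr)
    show "real_distribution (distr (completion N) borel (\<lambda>\<omega>. real_of_ereal (Z \<omega>)))"
      using Zr by (rule CN.real_distribution_distr)
    fix a b :: real assume ab: "a < b"
    have k: "cts_step a b \<in> borel_measurable borel"
      using continuous_on_cts_step[OF ab] by (rule borel_measurable_continuous_onI)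
    have "integral\<^sup>L (distr (completion N) borel (\<lambda>\<omega>. real_of_ereal (Z \<omega>))) (cts_step a b) =
        (\<integral>\<omega>. cts_step a b (real_of_ereal (Z \<omega>)) \<partial>completion N)"
      by (rule integral_distr[OF Zr k])
    also have "\<dots> = (\<integral>\<omega>. cts_step a b (?\<Phi> (B \<omega>)) \<partial>completion N)"
    proof (rule integral_cong_AE)
      show "AE \<omega> in completion N. cts_step a b (real_of_ereal (Z \<omega>)) = cts_step a b (?\<Phi> (B \<omega>))"
        using AE_completion[OF Z\<Phi>] by eventually_elim (metis real_of_ereal.simps(1))
    qed (use Zr k \<Phi>B in \<open>auto intro: measurable_compose measurable_completion\<close>)
    also have "\<dots> = (\<integral>\<omega>. cts_step a b (?\<Phi> (B \<omega>)) \<partial>N)"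
      using \<Phi>B k by (intro integral_completion) simp
    finally show "(\<lambda>n. integral\<^sup>L (distr P borel (\<lambda>s. ?d n (W n s))) (cts_step a b)) \<longlonglongrightarrow>
        integral\<^sup>L (distr (completion N) borel (\<lambda>\<omega>. real_of_ereal (Z \<omega>))) (cts_step a b)"
      using key[OF ab] by (simp add: integral_distr[OF meas k])
  qed
  moreover have "AE \<omega> in N. \<bar>Z \<omega>\<bar> \<noteq> \<infinity>"
    using Z\<Phi> by eventually_elim auto
  ultimately show ?thesis
    using meas Z_meas by (simp add: converges_in_distribution_def)
qed

end

section \<open>The three directional derivatives\<close>

lemma skorohod_uminus:
  assumes "f \<in> skorohod"
  shows "(\<lambda>x. - f x) \<in> skorohod"
proof (rule skorohodI)
  show "(\<lambda>x. - f x) \<in> mspace linf"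
    using assms by (simp add: skorohod_def mspace_linf_iff)
  show "((\<lambda>x. - f x) \<longlongrightarrow> - f x) (at x within quadrant (upper_dir x) x)" for x
    by (intro tendsto_intros skorohod_tendsto_upper assms)
  show "\<exists>l. ((\<lambda>x. - f x) \<longlongrightarrow> l) (at x within quadrant v x)"
    if "v \<in> quadrants" "quadrant v x \<noteq> {}" for x v
    using skorohod_tendsto_vlim[OF assms that] by (blast intro: tendsto_minus)
qed

lemma vlim_uminus:
  assumes "f \<in> skorohod" "v \<in> quadrants" "quadrant v x \<noteq> {}"
  shows "vlim v (\<lambda>x. - f x) x = - vlim v f x"
  by (intro vlim_tendstoI tendsto_intros skorohod_tendsto_vlim assms)

text \<open>Reflection replaces infima by suprema, so that the quotient result for
  \<open>sigma_sup\<close> also covers the second term of \<open>alpha\<close>.\<close>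

lemma M_minus_eq_M_plus_uminus:
  assumes "f \<in> skorohod" "v \<in> quadrants"
  shows "M_minus v f = M_plus v (\<lambda>x. - f x)"
proof -
  have "(INF y. f y) = - (SUP y. - f y)"
    by (simp add: Inf_real_def image_image)
  then have "vlim v f x = (INF y. f y) \<longleftrightarrow> vlim v (\<lambda>x. - f x) x = (SUP y. - f y)"
    if "quadrant v x \<noteq> {}" for x
    using vlim_uminus[OF assms that] by auto
  then show ?thesis
    unfolding M_minus_def M_plus_def by (intro Collect_cong) blast
qed

lemma tendsto_sigma_deriv:
  assumes "deriv_dom f g"
  shows "((\<lambda>t. ereal ((sigma_sup (\<lambda>x. f x + t * g x) - sigma_sup f) / t)) \<longlongrightarrow> sigma_deriv f g)
    (at_right 0)"
proof -
  have "\<exists>e>0. \<forall>a' b' t::real. \<bar>a' - a\<bar> < e \<longrightarrow> \<bar>b' - b\<bar> < e \<longrightarrow> 0 < t \<longrightarrow> t < e \<longrightarrow>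
      a' + t * b' \<le> a' + t * c" if "b < c" for a b c :: real
    using that by (intro exI[of _ "c - b"]) auto
  then show ?thesis
    using assms tendsto_difference_quotient_SUP[of f g "\<lambda>a. a" "\<lambda>a b. b"]
    by (simp add: sigma_deriv_def sigma_sup_def deriv_dom_def)
qed

text \<open>Close to a nonzero \<open>a\<close> the sign is constant, so the absolute value is
  linear there with slope \<open>sgn a\<close>.\<close>

lemma abs_deriv_upper:
  fixes a b c :: real
  assumes "a \<noteq> 0" "b * sgn a < c"
  shows "\<exists>e>0. \<forall>a' b' t. \<bar>a' - a\<bar> < e \<longrightarrow> \<bar>b' - b\<bar> < e \<longrightarrow> 0 < t \<longrightarrow> t < e \<longrightarrow>
    \<bar>a' + t * b'\<bar> \<le> \<bar>a'\<bar> + t * c"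
proof (intro exI conjI allI impI)
  \<comment> \<open>The first term keeps the directional slope of \<open>b'\<close> below
    \<open>c\<close>. The second gives \<open>\<bar>b'\<bar> \<le> \<bar>b\<bar> + 2\<close>, and
    with this the third keeps both \<open>a' - a\<close> and \<open>t * b'\<close> within half of
    \<open>\<bar>a\<bar>\<close>, so no sign changes.\<close>
  define e where "e = min (c - b * sgn a) (min 1 (\<bar>a\<bar> / 2 / (\<bar>b\<bar> + 2)))"
  show "0 < e" using assms by (simp add: e_def)
  have e: "e \<le> c - b * sgn a" "e \<le> 1" "e \<le> \<bar>a\<bar> / 2 / (\<bar>b\<bar> + 2)"
    unfolding e_def by linarith+
  fix a' b' t assume t: "\<bar>a' - a\<bar> < e" "\<bar>b' - b\<bar> < e" "0 < t" "t < e"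
  have "\<bar>b'\<bar> \<le> \<bar>b\<bar> + 2" using t e by linarith
  then have "\<bar>t * b'\<bar> \<le> t * (\<bar>b\<bar> + 2)" using t by (simp add: abs_mult)
  also have "\<dots> \<le> e * (\<bar>b\<bar> + 2)" using t by (intro mult_right_mono) auto
  also have "\<dots> \<le> \<bar>a\<bar> / 2" using e(3) by (simp add: pos_le_divide_eq algebra_simps)
  finally have tb: "\<bar>t * b'\<bar> \<le> \<bar>a\<bar> / 2" .
  have "\<bar>a\<bar> / 2 / (\<bar>b\<bar> + 2) \<le> \<bar>a\<bar> / 2 / 1" by (intro divide_left_mono) auto
  then have a': "\<bar>a' - a\<bar> < \<bar>a\<bar> / 2" using t e by linarith
  show "\<bar>a' + t * b'\<bar> \<le> \<bar>a'\<bar> + t * c"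
  proof (cases "a > 0")
    case True
    have "b' \<le> c" using t e True by simp
    then have "t * b' \<le> t * c" using t by (intro mult_left_mono) auto
    then show ?thesis using True tb a' by linarith
  next
    case False
    then have neg: "a < 0" using assms by simp
    have "- b' \<le> c" using t e neg by simp
    then have "t * (- b') \<le> t * c" using t by (intro mult_left_mono) auto
    then show ?thesis using neg tb a' by (simp add: abs_if split: if_splits)
  qed
qed

text \<open>As \<open>f\<close> is not zero, the supremum of its absolute value is positive. Maximal
  limits are then nonzero, which avoids the kink of the absolute value at 0, where the formula with
  \<open>sgn\<close> would fail.\<close>

lemma tendsto_delta_deriv:
  assumes "deriv_dom f g"
  shows "((\<lambda>t. ereal ((delta (\<lambda>x. f x + t * g x) - delta f) / t)) \<longlongrightarrow> delta_deriv f g)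
    (at_right 0)"
proof -
  have f: "f \<in> skorohod" "f \<noteq> (\<lambda>_. 0)" and g: "g \<in> skorohod"
    using assms by (auto simp: deriv_dom_def)
  have "bdd_above (range (\<lambda>y. \<bar>f y\<bar>))"
    using f(1) by (auto simp: skorohod_def mspace_linf_iff bdd_above_def)
  then have le: "\<bar>f y\<bar> \<le> (SUP y. \<bar>f y\<bar>)" for y
    by (intro cSUP_upper) auto
  obtain y where "f y \<noteq> 0" using f(2) by auto
  then have pos: "(SUP y. \<bar>f y\<bar>) > 0" using le[of y] by linarith
  have lower: "\<bar>a\<bar> + t * (b * sgn a) \<le> \<bar>a + t * b\<bar>" if "0 < t" for a b t :: real
  proof (cases "a > 0")
    case True
    then show ?thesis using abs_ge_self[of "a + t * b"] by (simp add: mult.commute)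
  next
    case False
    then show ?thesis
      using abs_ge_minus_self[of "a + t * b"] by (cases "a = 0") (simp_all add: mult.commute)
  qed
  have "\<bar>\<bar>a\<bar> - \<bar>b\<bar>\<bar> \<le> \<bar>a - b\<bar>" for a b :: real by linarith
  then show ?thesis
    using tendsto_difference_quotient_SUP[OF f(1) g lower, OF _ _ abs_deriv_upper] assms pos
    by (auto simp: delta_deriv_def delta_def)
qed

lemma le_sigma_sup:
  assumes "\<And>x. f x \<le> a"
  shows "f x \<le> sigma_sup f"
  unfolding sigma_sup_def using assms by (intro cSUP_upper bdd_aboveI2) auto

lemma sigma_sup_le:
  assumes "\<And>x. f x \<le> a"
  shows "sigma_sup f \<le> a"
  unfolding sigma_sup_def using assms by (intro cSUP_least) auto

lemma abs_sigma_sup_diff_le: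
  assumes a: "\<And>x. \<bar>f x\<bar> \<le> a" and c: "\<And>x. \<bar>f x - g x\<bar> \<le> c"
  shows "\<bar>sigma_sup f - sigma_sup g\<bar> \<le> c"
proof -
  have f: "f x \<le> sigma_sup f" for x
    by (rule le_sigma_sup[of f a]) (use a abs_le_D1 in blast)
  have "g x \<le> a + c" for x using a[of x] c[of x] by linarith
  then have g: "g x \<le> sigma_sup g" for x
    by (rule le_sigma_sup[of g])
  have "sigma_sup f \<le> sigma_sup g + c"
  proof (rule sigma_sup_le)
    show "f x \<le> sigma_sup g + c" for x using g[of x] c[of x] by linarith
  qed
  moreover have "sigma_sup g \<le> sigma_sup f + c"
  proof (rule sigma_sup_le)
    show "g x \<le> sigma_sup f + c" for x using f[of x] c[of x] by linarith
  qed
  ultimately show ?thesis by linarith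
qed

lemma alpha_eq_sigma_sup: "alpha f = sigma_sup f + sigma_sup (\<lambda>x. - f x)"
  by (simp add: alpha_def sigma_sup_def Inf_real_def image_image)

text \<open>The quotients, hence their limit, are bounded by any bound on the absolute value of
  \<open>g\<close>. Finiteness lets the two limits making up the derivative of \<open>alpha\<close>
  be added in \<open>ereal\<close>.\<close>

lemma sigma_deriv_finite:
  assumes "deriv_dom f g"
  shows "\<bar>sigma_deriv f g\<bar> \<noteq> \<infinity>"
proof -
  obtain a b where ab: "\<And>x. \<bar>f x\<bar> \<le> a" "\<And>x. \<bar>g x\<bar> \<le> b"
    using assms by (auto simp: deriv_dom_def skorohod_def mspace_linf_iff)
  have bound: "\<bar>(sigma_sup (\<lambda>x. f x + t * g x) - sigma_sup f) / t\<bar> \<le> b" if t: "t > 0" for t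
  proof -
    have "\<bar>sigma_sup f - sigma_sup (\<lambda>x. f x + t * g x)\<bar> \<le> t * b"
      using ab t by (intro abs_sigma_sup_diff_le[of f a]) (auto simp: abs_mult)
    then show ?thesis
      using t by (simp add: abs_divide pos_divide_le_eq abs_minus_commute mult.commute)
  qed
  have ev: "\<forall>\<^sub>F t in at_right 0. \<bar>(sigma_sup (\<lambda>x. f x + t * g x) - sigma_sup f) / t\<bar> \<le> b"
    using eventually_at_right_less by eventually_elim (rule bound)
  have "sigma_deriv f g \<le> ereal b"
  proof (rule tendsto_upperbound[OF tendsto_sigma_deriv[OF assms]])
    show "\<forall>\<^sub>F t in at_right 0. ereal ((sigma_sup (\<lambda>x. f x + t * g x) - sigma_sup f) / t) \<le> ereal b"
      using ev by eventually_elim (simp only: ereal_less_eq abs_le_iff)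
  qed simp
  moreover have "ereal (- b) \<le> sigma_deriv f g"
  proof (rule tendsto_lowerbound[OF tendsto_sigma_deriv[OF assms]])
    show "\<forall>\<^sub>F t in at_right 0. ereal (- b) \<le> ereal ((sigma_sup (\<lambda>x. f x + t * g x) - sigma_sup f) / t)"
      using ev by eventually_elim (simp only: ereal_less_eq abs_le_iff minus_le_iff)
  qed simp
  ultimately show ?thesis by auto
qed

text \<open>Infima over \<open>M_minus\<close> sets become negated suprema over
  \<open>M_plus\<close> sets of the reflected functions, and subtracting a negative adds.\<close>

lemma alpha_deriv_eq_sigma_deriv:
  assumes "deriv_dom f g"
  shows "alpha_deriv f g = sigma_deriv f g + sigma_deriv (\<lambda>x. - f x) (\<lambda>x. - g x)"
proof -
  have f: "f \<in> skorohod" and g: "g \<in> skorohod" using assms by (auto simp: deriv_dom_def)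
  have dom: "deriv_dom (\<lambda>x. - f x) (\<lambda>x. - g x)"
    using assms by (auto simp: deriv_dom_def skorohod_uminus fun_eq_iff)
  have "(INF x\<in>M_minus v f. ereal (vlim v g x)) =
      - (SUP x\<in>M_plus v (\<lambda>x. - f x). ereal (vlim v (\<lambda>x. - g x) x))" if v: "v \<in> quadrants" for v
  proof -
    have "ereal (vlim v g x) = - ereal (vlim v (\<lambda>x. - g x) x)" if "x \<in> M_plus v (\<lambda>x. - f x)" for x
      using vlim_uminus[OF g v] that by (auto simp: M_plus_def)
    then have "(INF x\<in>M_minus v f. ereal (vlim v g x)) =
        (INF x\<in>M_plus v (\<lambda>x. - f x). - ereal (vlim v (\<lambda>x. - g x) x))"
      unfolding M_minus_eq_M_plus_uminus[OF f v] by (intro INF_cong) auto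
    then show ?thesis unfolding ereal_INF_uminus_eq .
  qed
  then have "(MIN v\<in>quadrants. INF x\<in>M_minus v f. ereal (vlim v g x)) =
      - (MAX v\<in>quadrants. SUP x\<in>M_plus v (\<lambda>x. - f x). ereal (vlim v (\<lambda>x. - g x) x))"
    unfolding Max_ereal_eq_SUP Min_ereal_eq_INF ereal_INF_uminus_eq[symmetric]
    by (rule INF_cong[OF refl])
  then show ?thesis
    using assms dom by (simp add: alpha_deriv_def sigma_deriv_def minus_ereal_def)
qed

lemma tendsto_alpha_deriv:
  assumes "deriv_dom f g"
  shows "((\<lambda>t. ereal ((alpha (\<lambda>x. f x + t * g x) - alpha f) / t)) \<longlongrightarrow> alpha_deriv f g)
    (at_right 0)"
proof -
  have dom: "deriv_dom (\<lambda>x. - f x) (\<lambda>x. - g x)"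
    using assms by (auto simp: deriv_dom_def skorohod_uminus fun_eq_iff)
  have "((\<lambda>t. ereal ((sigma_sup (\<lambda>x. f x + t * g x) - sigma_sup f) / t) +
      ereal ((sigma_sup (\<lambda>x. - f x + t * - g x) - sigma_sup (\<lambda>x. - f x)) / t)) \<longlongrightarrow>
      alpha_deriv f g) (at_right 0)"
    unfolding alpha_deriv_eq_sigma_deriv[OF assms]
    using sigma_deriv_finite[OF assms] sigma_deriv_finite[OF dom]
    by (intro tendsto_add_ereal tendsto_sigma_deriv assms dom)
  then show ?thesis
    by (simp add: alpha_eq_sigma_sup add_divide_distrib diff_divide_distrib algebra_simps)
qed

section \<open>Convexity and measurability of the functionals\<close>

lemma linf_boundE:
  assumes "f \<in> mspace linf"
  obtains a where "\<forall>x. \<bar>f x\<bar> \<le> a"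
  using assms by (auto simp: mspace_linf_iff)

lemma sigma_sup_lipschitz:
  assumes "f \<in> mspace linf" "g \<in> mspace linf"
  shows "\<bar>sigma_sup f - sigma_sup g\<bar> \<le> mdist linf f g"
proof -
  obtain a where a: "\<forall>x. \<bar>f x\<bar> \<le> a" by (rule linf_boundE[OF assms(1)])
  show ?thesis
    by (rule abs_sigma_sup_diff_le[of f a]) (use a abs_diff_le_mdist_linf[OF assms] in auto)
qed

lemma sigma_sup_upper:
  assumes "f \<in> mspace linf"
  shows "f x \<le> sigma_sup f"
proof -
  obtain a where a: "\<forall>x. \<bar>f x\<bar> \<le> a" by (rule linf_boundE[OF assms])
  show ?thesis by (rule le_sigma_sup[of f a]) (use a abs_le_D1 in blast)
qed

lemma mspace_linf_abs: "f \<in> mspace linf \<Longrightarrow> (\<lambda>x. \<bar>f x\<bar>) \<in> mspace linf"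
  by (simp add: mspace_linf_iff)

lemma mspace_linf_uminus: "f \<in> mspace linf \<Longrightarrow> (\<lambda>x. - f x) \<in> mspace linf"
  by (simp add: mspace_linf_iff)

lemma convex_lipschitz_sigma_sup: "convex_lipschitz sigma_sup 1"
proof
  fix f g :: "ereal ^ 'a \<Rightarrow> real" and u :: real
  assume f: "f \<in> mspace linf" and g: "g \<in> mspace linf" and u: "0 \<le> u" "u \<le> 1"
  show "sigma_sup (\<lambda>x. (1 - u) * f x + u * g x) \<le> (1 - u) * sigma_sup f + u * sigma_sup g"
    by (intro sigma_sup_le add_mono mult_left_mono sigma_sup_upper f g) (use u in auto)
qed (use sigma_sup_lipschitz in auto)

lemma delta_eq_sigma_sup: "delta f = sigma_sup (\<lambda>x. \<bar>f x\<bar>)"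
  by (simp add: delta_def sigma_sup_def)

lemma convex_lipschitz_delta: "convex_lipschitz delta 1"
proof
  fix f g :: "ereal ^ 'a \<Rightarrow> real"
  assume f: "f \<in> mspace linf" and g: "g \<in> mspace linf"
  show "delta (\<lambda>x. (1 - u) * f x + u * g x) \<le> (1 - u) * delta f + u * delta g"
    if u: "0 \<le> u" "u \<le> 1" for u :: real
    unfolding delta_eq_sigma_sup
  proof (rule sigma_sup_le)
    fix x
    have "\<bar>(1 - u) * f x + u * g x\<bar> \<le> (1 - u) * \<bar>f x\<bar> + u * \<bar>g x\<bar>"
      using abs_triangle_ineq[of "(1 - u) * f x" "u * g x"] u by (simp add: abs_mult)
    also have "\<dots> \<le> (1 - u) * sigma_sup (\<lambda>x. \<bar>f x\<bar>) + u * sigma_sup (\<lambda>x. \<bar>g x\<bar>)"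
      using u sigma_sup_upper[OF mspace_linf_abs[OF f]] sigma_sup_upper[OF mspace_linf_abs[OF g]]
      by (intro add_mono mult_left_mono) auto
    finally show "\<bar>(1 - u) * f x + u * g x\<bar> \<le>
        (1 - u) * sigma_sup (\<lambda>x. \<bar>f x\<bar>) + u * sigma_sup (\<lambda>x. \<bar>g x\<bar>)" .
  qed
  obtain a where a: "\<forall>x. \<bar>f x\<bar> \<le> a" by (rule linf_boundE[OF f])
  have "\<bar>\<bar>f x\<bar> - \<bar>g x\<bar>\<bar> \<le> mdist linf f g" for x
    using abs_triangle_ineq3 abs_diff_le_mdist_linf[OF f g] by (rule order.trans)
  then show "\<bar>delta f - delta g\<bar> \<le> 1 * mdist linf f g"
    unfolding delta_eq_sigma_sup using a by (simp add: abs_sigma_sup_diff_le[of _ a])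
qed simp

text \<open>Both properties are inherited from \<open>sigma_sup\<close> at \<open>f\<close> and at
  its negative; the two Lipschitz constants add up to 2.\<close>

lemma convex_lipschitz_alpha: "convex_lipschitz alpha 2"
proof
  interpret convex_lipschitz "sigma_sup :: (ereal ^ 'a \<Rightarrow> real) \<Rightarrow> real" 1
    by (rule convex_lipschitz_sigma_sup)
  fix f g :: "ereal ^ 'a \<Rightarrow> real"
  assume f: "f \<in> mspace linf" and g: "g \<in> mspace linf"
  note f' = mspace_linf_uminus[OF f] and g' = mspace_linf_uminus[OF g]
  show "alpha (\<lambda>x. (1 - u) * f x + u * g x) \<le> (1 - u) * alpha f + u * alpha g"
    if u: "0 \<le> u" "u \<le> 1" for u :: real
  proof -
    have "(\<lambda>x. - ((1 - u) * f x + u * g x)) = (\<lambda>x. (1 - u) * - f x + u * - g x)"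
      by (simp add: fun_eq_iff algebra_simps)
    then show ?thesis
      using convex[OF f g u] convex[OF f' g' u] unfolding alpha_eq_sigma_sup
      by (simp add: algebra_simps)
  qed
  have "mdist linf (\<lambda>x. - f x) (\<lambda>x. - g x) \<le> mdist linf f g"
  proof (rule mdist_linf_le[OF f' g'])
    show "\<bar>- f x - - g x\<bar> \<le> mdist linf f g" for x
      using abs_diff_le_mdist_linf[OF f g, of x] by linarith
  qed
  then show "\<bar>alpha f - alpha g\<bar> \<le> 2 * mdist linf f g"
    using lipschitz[OF f g] lipschitz[OF f' g'] unfolding alpha_eq_sigma_sup by linarith
qed simp

lemma scaled_diff_tendsto_if_quotient_tendsto:
  assumes "((\<lambda>t. ereal ((\<phi> (\<lambda>x. f x + t * g x) - \<phi> f) / t)) \<longlongrightarrow> L) (at_right 0)"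
  shows "(\<lambda>n. ereal (scaled_diff \<phi> f n g)) \<longlonglongrightarrow> L"
proof -
  have "filterlim (\<lambda>n. sqrt (real n)) at_top sequentially"
    by (intro filterlim_compose[OF sqrt_at_top filterlim_real_sequentially])
  then have "filterlim (\<lambda>n. inverse (sqrt (real n))) (at_right 0) sequentially"
    by (rule filterlim_compose[OF filterlim_inverse_at_right_top])
  from filterlim_compose[OF assms this] show ?thesis
    by (simp add: scaled_diff_def field_simps)
qed

section \<open>Operations preserving the Skorohod space\<close>

lemma skorohod_abs:
  assumes "f \<in> skorohod"
  shows "(\<lambda>x. \<bar>f x\<bar>) \<in> skorohod"
proof (rule skorohodI)
  show "(\<lambda>x. \<bar>f x\<bar>) \<in> mspace linf"
    by (intro mspace_linf_abs skorohod_subset_linf assms)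
  show "((\<lambda>x. \<bar>f x\<bar>) \<longlongrightarrow> \<bar>f x\<bar>) (at x within quadrant (upper_dir x) x)" for x
    by (intro tendsto_intros skorohod_tendsto_upper assms)
  show "\<exists>l. ((\<lambda>x. \<bar>f x\<bar>) \<longlongrightarrow> l) (at x within quadrant v x)"
    if "v \<in> quadrants" "quadrant v x \<noteq> {}" for x v
    using skorohod_tendsto_vlim[OF assms that] by (blast intro: tendsto_rabs)
qed

lemma skorohod_add_scaled:
  assumes "f \<in> skorohod" "g \<in> skorohod"
  shows "(\<lambda>x. f x + t * g x) \<in> skorohod"
proof (rule skorohodI)
  show "(\<lambda>x. f x + t * g x) \<in> mspace linf"
    by (intro mspace_linf_add_scaled skorohod_subset_linf assms)
  show "((\<lambda>x. f x + t * g x) \<longlongrightarrow> f x + t * g x) (at x within quadrant (upper_dir x) x)" for x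
    by (intro tendsto_intros skorohod_tendsto_upper assms)
  show "\<exists>l. ((\<lambda>x. f x + t * g x) \<longlongrightarrow> l) (at x within quadrant v x)"
    if v: "v \<in> quadrants" "quadrant v x \<noteq> {}" for x v
    by (intro exI[of _ "vlim v f x + t * vlim v g x"] tendsto_intros skorohod_tendsto_vlim assms v)
qed

lemma skorohod_scaled: "f \<in> skorohod \<Longrightarrow> (\<lambda>x. t * f x) \<in> skorohod"
  using skorohod_add_scaled[OF zero_skorohod, of f t] by simp

lemma skorohod_diff: "\<lbrakk>f \<in> skorohod; g \<in> skorohod\<rbrakk> \<Longrightarrow> (\<lambda>x. f x - g x) \<in> skorohod"
  using skorohod_add_scaled[of f g "-1"] by simp

lemma skorohod_sum:
  assumes "\<And>i. i \<in> I \<Longrightarrow> f i \<in> skorohod"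
  shows "(\<lambda>x. \<Sum>i\<in>I. f i x) \<in> skorohod"
  using assms
proof (induction I rule: infinite_finite_induct)
  case (insert i I)
  then show ?case
    using skorohod_add_scaled[of "f i" "\<lambda>x. \<Sum>i\<in>I. f i x" 1] by simp
qed (simp_all add: zero_skorohod)

section \<open>Distribution functions and their empirical versions\<close>

text \<open>A strict inequality between \<open>z $ i\<close> and \<open>x $ i\<close> settles the
  comparison for all \<open>y\<close> near \<open>x\<close>. If they are equal, the side on which
  the half-line lies settles it.\<close>

lemma eventually_ereal_vec_le_iff:
  fixes z :: "real ^ 'd" and x :: "ereal ^ 'd" and v :: "int ^ 'd"
  shows
  "\<forall>\<^sub>F y in at x within quadrant v x. ereal_vec z \<le> y \<longleftrightarrow>
     (\<forall>i. if v $ i = 1 then ereal (z $ i) \<le> x $ i else ereal (z $ i) < x $ i)"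
proof -
  let ?F = "at x within quadrant v x"
  have Q: "\<forall>\<^sub>F y in ?F. y \<in> quadrant v x"
    unfolding eventually_at_topological by auto
  have "\<forall>\<^sub>F y in ?F. ereal (z $ i) \<le> y $ i \<longleftrightarrow>
      (if v $ i = 1 then ereal (z $ i) \<le> x $ i else ereal (z $ i) < x $ i)" for i
  proof -
    have lim: "((\<lambda>y. y $ i) \<longlongrightarrow> x $ i) ?F"
      by (intro tendsto_vec_nth tendsto_ident_at)
    have hl: "\<forall>\<^sub>F y in ?F. y $ i \<in> half_line (v $ i) (x $ i)"
      using Q by eventually_elim (simp add: quadrant_def)
    show ?thesis
    proof (cases "x $ i < ereal (z $ i)")
      case True
      from order_tendstoD(2)[OF lim True] show ?thesis
        by eventually_elim (use True in auto)
    next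
      case False
      show ?thesis
      proof (cases "ereal (z $ i) < x $ i")
        case True
        from order_tendstoD(1)[OF lim True] show ?thesis
          by eventually_elim (use True in auto)
      next
        case eq: False
        then have "x $ i = ereal (z $ i)" using False by simp
        with hl have "\<forall>\<^sub>F y in ?F. y $ i \<in> half_line (v $ i) (ereal (z $ i))" by simp
        then show ?thesis
          by eventually_elim
            (use \<open>x $ i = ereal (z $ i)\<close> in \<open>auto simp: half_line_def split: if_splits\<close>)
      qed
    qed
  qed
  then have "\<forall>\<^sub>F y in ?F. \<forall>i. ereal (z $ i) \<le> y $ i \<longleftrightarrow>
      (if v $ i = 1 then ereal (z $ i) \<le> x $ i else ereal (z $ i) < x $ i)"
    by (rule eventually_all_finite)
  then show ?thesis
    by eventually_elim (auto simp: less_eq_vec_def ereal_vec_def)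
qed

text \<open>The strict inequality occurs only where \<open>x $ i\<close> is infinite, and there it
  holds since \<open>z\<close> is real.\<close>

lemma upper_dir_le_iff:
  "(\<forall>i. if upper_dir x $ i = 1 then ereal (z $ i) \<le> x $ i else ereal (z $ i) < x $ i) \<longleftrightarrow>
     ereal_vec z \<le> x"
proof -
  have "(if upper_dir x $ i = 1 then ereal (z $ i) \<le> x $ i else ereal (z $ i) < x $ i) \<longleftrightarrow>
      ereal (z $ i) \<le> x $ i" for i
    by (cases "x $ i = \<infinity>") (simp_all add: upper_dir_def)
  then show ?thesis by (simp add: less_eq_vec_def ereal_vec_def)
qed

lemma tendsto_indicator_ereal_vec_le:
  fixes z :: "real ^ 'd" and x :: "ereal ^ 'd" and v :: "int ^ 'd"
  shows
  "((\<lambda>y. if ereal_vec z \<le> y then 1 else 0 :: real) \<longlongrightarrow>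
     (if \<forall>i. if v $ i = 1 then ereal (z $ i) \<le> x $ i else ereal (z $ i) < x $ i then 1 else 0))
     (at x within quadrant v x)"
  by (rule tendsto_eventually) (rule eventually_mono[OF eventually_ereal_vec_le_iff[of z v x]], simp)

lemma indicator_ereal_vec_le_skorohod: "(\<lambda>y. if ereal_vec z \<le> y then 1 else 0) \<in> skorohod"
proof (rule skorohodI)
  show "(\<lambda>y. if ereal_vec z \<le> y then 1 else 0) \<in> mspace linf"
    unfolding mspace_linf_iff by (intro exI[of _ 1]) auto
  show "((\<lambda>y. if ereal_vec z \<le> y then 1 else 0 :: real) \<longlongrightarrow> (if ereal_vec z \<le> x then 1 else 0))
      (at x within quadrant (upper_dir x) x)" for x
    using tendsto_indicator_ereal_vec_le[of z "upper_dir x" x] by (simp only: upper_dir_le_iff)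
qed (use tendsto_indicator_ereal_vec_le in blast)

lemma emp_cdf_skorohod: "emp_cdf S n \<omega> \<in> skorohod"
proof -
  have "emp_cdf S n \<omega> = (\<lambda>x. (1 / real n) * (\<Sum>i<n. if ereal_vec (S i \<omega>) \<le> x then 1 else 0))"
    by (simp add: fun_eq_iff emp_cdf_def)
  then show ?thesis
    by (simp only:) (intro skorohod_scaled skorohod_sum indicator_ereal_vec_le_skorohod)
qed

lemma sets_quadrant_le:
  "{z :: real ^ 'd. \<forall>i. if Q i then ereal (z $ i) \<le> x $ i else ereal (z $ i) < x $ i} \<in> sets borel"
proof -
  have [measurable]: "(\<lambda>z :: real ^ 'd. z $ i) \<in> borel_measurable borel" for i
    by (intro borel_measurable_continuous_onI continuous_intros)
  have "{z :: real ^ 'd. if Q i then ereal (z $ i) \<le> x $ i else ereal (z $ i) < x $ i} \<in> sets borel" for i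
    by (cases "Q i") simp_all
  then have "(\<Inter>i. {z :: real ^ 'd. if Q i then ereal (z $ i) \<le> x $ i else ereal (z $ i) < x $ i}) \<in> sets borel"
    by (intro sets.finite_INT) auto
  then show ?thesis by (simp only: Collect_all_eq)
qed

lemma sets_ereal_vec_le [measurable]: "{z :: real ^ 'd. ereal_vec z \<le> x} \<in> sets borel"
  using sets_quadrant_le[of "\<lambda>_. True" x] by (simp add: less_eq_vec_def ereal_vec_def)

text \<open>The distribution function is an average of indicators whose quadrant limits are known;
  dominated convergence moves the limit inside the integral.\<close>

lemma joint_cdf_skorohod:
  fixes X :: "'a \<Rightarrow> real ^ 'd"
  assumes M: "prob_space M" and X [measurable]: "X \<in> borel_measurable M"
  shows "joint_cdf M X \<in> skorohod"
proof -
  interpret prob_space M by fact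
  have eq: "joint_cdf M X x = (\<integral>\<omega>. (if ereal_vec (X \<omega>) \<le> x then 1 else 0) \<partial>M)" for x
  proof -
    have "(\<integral>\<omega>. (if ereal_vec (X \<omega>) \<le> x then 1 else 0) \<partial>M) =
        (\<integral>\<omega>. indicator {\<omega> \<in> space M. ereal_vec (X \<omega>) \<le> x} \<omega> \<partial>M)"
      by (rule Bochner_Integration.integral_cong) (auto simp: indicator_def)
    also have "\<dots> = measure M {\<omega> \<in> space M. ereal_vec (X \<omega>) \<le> x}"
      by (subst Bochner_Integration.integral_indicator) (auto intro!: arg_cong[of _ _ "measure M"])
    finally show ?thesis by (simp add: joint_cdf_def)
  qed
  have lim: "(joint_cdf M X \<longlongrightarrow> (\<integral>\<omega>. (if \<forall>i. if v $ i = 1 then ereal (X \<omega> $ i) \<le> x $ i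
      else ereal (X \<omega> $ i) < x $ i then 1 else 0) \<partial>M)) (at x within quadrant v x)" for v x
    unfolding tendsto_at_iff_sequentially comp_def eq
  proof (intro allI impI)
    fix s :: "nat \<Rightarrow> ereal ^ 'd" assume s: "\<forall>i. s i \<in> quadrant v x - {x}" "s \<longlonglongrightarrow> x"
    show "(\<lambda>n. \<integral>\<omega>. (if ereal_vec (X \<omega>) \<le> s n then 1 else 0 :: real) \<partial>M) \<longlonglongrightarrow>
        (\<integral>\<omega>. (if \<forall>i. if v $ i = 1 then ereal (X \<omega> $ i) \<le> x $ i
          else ereal (X \<omega> $ i) < x $ i then 1 else 0) \<partial>M)"
    proof (rule integral_dominated_convergence[where w="\<lambda>_. 1"])
      show "(\<lambda>\<omega>. if ereal_vec (X \<omega>) \<le> s n then 1 else 0 :: real) \<in> borel_measurable M" for n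
        using measurable_sets[OF X sets_ereal_vec_le[of "s n"]]
        by (intro measurable_If) (simp_all add: vimage_def Int_def conj_commute)
      show "(\<lambda>\<omega>. if \<forall>i. if v $ i = 1 then ereal (X \<omega> $ i) \<le> x $ i
          else ereal (X \<omega> $ i) < x $ i then 1 else 0 :: real) \<in> borel_measurable M"
        using measurable_sets[OF X sets_quadrant_le[of "\<lambda>i. v $ i = 1" x]]
        by (intro measurable_If) (simp_all add: vimage_def Int_def conj_commute)
      show "AE \<omega> in M. (\<lambda>n. if ereal_vec (X \<omega>) \<le> s n then 1 else 0 :: real) \<longlonglongrightarrow>
          (if \<forall>i. if v $ i = 1 then ereal (X \<omega> $ i) \<le> x $ i
            else ereal (X \<omega> $ i) < x $ i then 1 else 0)"
      proof (rule AE_I2)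
        fix \<omega>
        show "(\<lambda>n. if ereal_vec (X \<omega>) \<le> s n then 1 else 0 :: real) \<longlonglongrightarrow>
          (if \<forall>i. if v $ i = 1 then ereal (X \<omega> $ i) \<le> x $ i
            else ereal (X \<omega> $ i) < x $ i then 1 else 0)"
          using tendsto_indicator_ereal_vec_le[of "X \<omega>" v x] s
          unfolding tendsto_at_iff_sequentially comp_def by simp
      qed
    qed auto
  qed
  show ?thesis
  proof (rule skorohodI)
    show "joint_cdf M X \<in> mspace linf"
      unfolding mspace_linf_iff joint_cdf_def by (intro exI[of _ 1]) simp
    show "(joint_cdf M X \<longlongrightarrow> joint_cdf M X x) (at x within quadrant (upper_dir x) x)" for x
      using lim[of "upper_dir x" x] by (simp only: upper_dir_le_iff eq)
  qed (use lim in blast)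
qed

text \<open>Continuity from above makes a countable dense set of points suffice for the supremum.\<close>

lemma borel_measurable_sigma_sup:
  fixes f :: "'a \<Rightarrow> ereal ^ 'd \<Rightarrow> real"
  assumes meas: "\<And>x. (\<lambda>s. f s x) \<in> borel_measurable M"
    and sk: "\<And>s. s \<in> space M \<Longrightarrow> f s \<in> skorohod"
  shows "(\<lambda>s. sigma_sup (f s)) \<in> borel_measurable M"
proof -
  obtain E :: "(ereal ^ 'd) set" where E: "countable E"
      "\<And>U. open U \<Longrightarrow> U \<noteq> {} \<Longrightarrow> \<exists>e\<in>E. e \<in> U"
    by (rule countable_dense_ereal_vec) blast
  have "E \<noteq> {}" using E(2)[of UNIV] by auto
  have bdd: "bdd_above (f s ` E)" if "s \<in> space M" for s
    using sigma_sup_upper[OF skorohod_subset_linf[OF sk[OF that]]] by (rule bdd_aboveI2)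
  have "sigma_sup (f s) = (SUP e\<in>E. f s e)" if s: "s \<in> space M" for s
  proof (rule antisym)
    show "(SUP e\<in>E. f s e) \<le> sigma_sup (f s)"
      using \<open>E \<noteq> {}\<close> sigma_sup_upper[OF skorohod_subset_linf[OF sk[OF s]]] by (rule cSUP_least)
    show "sigma_sup (f s) \<le> (SUP e\<in>E. f s e)"
    proof (rule sigma_sup_le, rule ccontr)
      \<comment> \<open>A value exceeding the supremum over \<open>E\<close> would persist, near
        \<open>x\<close>, on an open nonempty piece of the upper quadrant, and that piece meets
        \<open>E\<close>.\<close>
      fix x assume "\<not> f s x \<le> (SUP e\<in>E. f s e)"
      then have "(SUP e\<in>E. f s e) < f s x" by simp
      then have "\<forall>\<^sub>F y in at x within quadrant (upper_dir x) x. (SUP e\<in>E. f s e) < f s y"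
        by (rule order_tendstoD(1)[OF skorohod_tendsto_upper[OF sk[OF s]]])
      then obtain U where U: "open U" "x \<in> U"
        and gt: "\<forall>y\<in>U. y \<noteq> x \<longrightarrow> y \<in> quadrant (upper_dir x) x \<longrightarrow> (SUP e\<in>E. f s e) < f s y"
        unfolding eventually_at_topological by auto
      have "\<forall>\<^sub>F y in at x within quadrant (upper_dir x) x. y \<in> U \<inter> quadrant (upper_dir x) x"
        unfolding eventually_at_topological using U by auto
      then have "U \<inter> quadrant (upper_dir x) x \<noteq> {}"
        using eventually_happens'[OF at_within_quadrant_neq_bot[OF quadrant_upper_dir_nonempty]]
        by blast
      then obtain e where e: "e \<in> E" "e \<in> U \<inter> quadrant (upper_dir x) x"
        using E(2)[OF open_Int[OF U(1) open_quadrant]] by blast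
      then have "(SUP e\<in>E. f s e) < f s e"
        using gt notin_quadrant[of x] by auto
      moreover have "f s e \<le> (SUP e\<in>E. f s e)"
        by (rule cSUP_upper[OF e(1) bdd[OF s]])
      ultimately show False by simp
    qed
  qed
  moreover have "(\<lambda>s. SUP e\<in>E. f s e) \<in> borel_measurable M"
    by (rule borel_measurable_cSUP[OF E(1) meas bdd])
  ultimately show ?thesis
    by (simp cong: measurable_cong)
qed

lemma borel_measurable_delta:
  assumes "\<And>x. (\<lambda>s. f s x) \<in> borel_measurable M" "\<And>s. s \<in> space M \<Longrightarrow> f s \<in> skorohod"
  shows "(\<lambda>s. delta (f s)) \<in> borel_measurable M"
  unfolding delta_eq_sigma_sup
  using assms by (intro borel_measurable_sigma_sup skorohod_abs) auto

lemma borel_measurable_alpha: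
  assumes "\<And>x. (\<lambda>s. f s x) \<in> borel_measurable M" "\<And>s. s \<in> space M \<Longrightarrow> f s \<in> skorohod"
  shows "(\<lambda>s. alpha (f s)) \<in> borel_measurable M"
  unfolding alpha_eq_sigma_sup
  using assms by (intro borel_measurable_add borel_measurable_sigma_sup skorohod_uminus) auto

text \<open>The bridge is tied to the coordinate sample on a product space. Only the laws of the
  \<open>D n\<close> matter, so the result pulls back along a measure-preserving map to any
  sample.\<close>

lemma converges_in_distribution_transfer:
  assumes conv: "converges_in_distribution P D N Z"
    and T: "T \<in> M \<rightarrow>\<^sub>M P" and P: "distr M P T = P"
  shows "converges_in_distribution M (\<lambda>n \<omega>. D n (T \<omega>)) N Z"
proof -
  have D: "D n \<in> borel_measurable P" for n
    using conv by (simp add: converges_in_distribution_def)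
  have "distr M borel (\<lambda>\<omega>. D n (T \<omega>)) = distr P borel (D n)" for n
    using distr_distr[OF D T] by (simp add: P comp_def)
  then show ?thesis
    using conv measurable_compose[OF T D] by (simp add: converges_in_distribution_def)
qed

lemma joint_cdf_distr:
  assumes X: "X \<in> borel_measurable M"
  shows "joint_cdf (distr M borel X) (\<lambda>y. y) = joint_cdf M X"
proof
  fix x
  show "joint_cdf (distr M borel X) (\<lambda>y. y) x = joint_cdf M X x"
    unfolding joint_cdf_def
    by (subst measure_distr[OF X]) (auto simp: sets_ereal_vec_le intro!: arg_cong[of _ _ "measure M"])
qed

text \<open>Independence with a common marginal law means that the whole sequence has the product
  law; this provides the measure-preserving map.\<close>

lemma distr_random_sample:
  fixes S :: "nat \<Rightarrow> 'c \<Rightarrow> real ^ 'd"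
  assumes "random_sample M S MX X"
  shows "(\<lambda>\<omega> i. S i \<omega>) \<in> M \<rightarrow>\<^sub>M PiM UNIV (\<lambda>_. distr MX borel X)"
    and "distr M (PiM UNIV (\<lambda>_. distr MX borel X)) (\<lambda>\<omega> i. S i \<omega>) = PiM UNIV (\<lambda>_. distr MX borel X)"
proof -
  interpret prob_space M using assms by (simp add: random_sample_def)
  have indep: "indep_vars (\<lambda>_. borel) S UNIV"
    and law: "\<And>i. distr M borel (S i) = distr MX borel X"
    using assms by (auto simp: random_sample_def)
  have S: "S i \<in> borel_measurable M" for i
    using indep by (simp add: indep_vars_def)
  have sets: "sets (PiM UNIV (\<lambda>_::nat. distr MX borel X)) = sets (PiM UNIV (\<lambda>_. borel))"
    by (intro sets_PiM_cong) auto
  have "(\<lambda>\<omega> i. S i \<omega>) \<in> M \<rightarrow>\<^sub>M PiM UNIV (\<lambda>_. borel)"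
    using S by (intro measurable_PiM_single') auto
  then show "(\<lambda>\<omega> i. S i \<omega>) \<in> M \<rightarrow>\<^sub>M PiM UNIV (\<lambda>_. distr MX borel X)"
    using measurable_cong_sets[OF refl sets] by blast
  have "distr M (PiM UNIV (\<lambda>_. borel)) (\<lambda>\<omega>. \<lambda>i\<in>UNIV. S i \<omega>) = PiM UNIV (\<lambda>i. distr M borel (S i))"
    using indep_vars_iff_distr_eq_PiM[of UNIV S "\<lambda>_. borel"] S indep by simp
  then show "distr M (PiM UNIV (\<lambda>_. distr MX borel X)) (\<lambda>\<omega> i. S i \<omega>) =
      PiM UNIV (\<lambda>_. distr MX borel X)"
    using distr_cong[OF refl sets, of M "\<lambda>\<omega> i. S i \<omega>" "\<lambda>\<omega> i. S i \<omega>"]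
    by (simp add: law restrict_UNIV)
qed

text \<open>The part common to the three functionals: \<open>\<phi>\<close> enters through
  convexity, its Lipschitz bound, measurability along Skorohod paths and its one-sided derivative at
  \<open>f\<close>.\<close>

lemma empirical_delta_method:
  fixes MX :: "'a measure" and X :: "'a \<Rightarrow> real ^ 'd" and S :: "nat \<Rightarrow> 'c \<Rightarrow> real ^ 'd"
    and B :: "'e \<Rightarrow> ereal ^ 'd \<Rightarrow> real" and G :: "ereal ^ 'd \<Rightarrow> real"
  defines "f \<equiv> \<lambda>x. joint_cdf MX X x - G x"
  assumes MX: "prob_space MX" and X: "X \<in> borel_measurable MX"
    and G: "G \<in> skorohod" and neq: "joint_cdf MX X \<noteq> G"
    and sample: "random_sample M S MX X"
    and bridge: "brownian_bridge (distr MX borel X) N B"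
    and \<phi>: "convex_lipschitz \<phi> C"
    and meas: "\<And>P (h :: (nat \<Rightarrow> real ^ 'd) \<Rightarrow> ereal ^ 'd \<Rightarrow> real).
      (\<And>x. (\<lambda>s. h s x) \<in> borel_measurable P) \<Longrightarrow> (\<And>s. s \<in> space P \<Longrightarrow> h s \<in> skorohod) \<Longrightarrow>
      (\<lambda>s. \<phi> (h s)) \<in> borel_measurable P"
    and deriv: "\<And>g. deriv_dom f g \<Longrightarrow>
      ((\<lambda>t. ereal ((\<phi> (\<lambda>x. f x + t * g x) - \<phi> f) / t)) \<longlongrightarrow> Df g) (at_right 0)"
  shows "converges_in_distribution M
    (\<lambda>n \<omega>. sqrt (real n) * (\<phi> (\<lambda>x. emp_cdf S n \<omega> x - G x) - \<phi> f)) N (\<lambda>\<omega>. Df (B \<omega>))"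
proof -
  interpret convex_lipschitz \<phi> C by fact
  define F where "F = joint_cdf MX X"
  define P where "P = PiM (UNIV :: nat set) (\<lambda>_. distr MX borel X)"
  define W where "W n s x = sqrt (real n) * (emp_cdf (\<lambda>i s. s i) n s x - F x)"
    for n and s :: "nat \<Rightarrow> real ^ 'd" and x
  define T where "T \<omega> i = S i \<omega>" for \<omega> i
  have F: "F \<in> skorohod" unfolding F_def by (rule joint_cdf_skorohod[OF MX X])
  have f_eq: "f = (\<lambda>x. F x - G x)" by (simp add: f_def F_def)
  have f: "f \<in> skorohod" unfolding f_eq by (rule skorohod_diff[OF F G])
  have "f \<noteq> (\<lambda>_. 0)" using neq by (auto simp: f_def fun_eq_iff)
  with f have dom: "deriv_dom f g" if "g \<in> skorohod" for g
    using that by (simp add: deriv_dom_def)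
  have P: "prob_space P"
    unfolding P_def by (intro prob_space_PiM prob_space.prob_space_distr[OF MX X])
  have N: "prob_space N" and conv: "converges_weakly linf P W N B"
    using bridge unfolding brownian_bridge_def Let_def joint_cdf_distr[OF X] P_def W_def F_def
    by simp_all
  have W: "W n s \<in> skorohod" for n s
    unfolding W_def by (intro skorohod_scaled skorohod_diff emp_cdf_skorohod F)
  have comp: "(\<lambda>s. s i) \<in> P \<rightarrow>\<^sub>M borel" for i
    unfolding P_def using measurable_component_singleton[of i UNIV "\<lambda>_. distr MX borel X"] by simp
  have W_meas: "(\<lambda>s. W n s x) \<in> borel_measurable P" for n x
  proof -
    have "(\<lambda>s. if ereal_vec (s i) \<le> x then 1 else 0 :: real) \<in> borel_measurable P" for i
      using measurable_sets[OF comp sets_ereal_vec_le, of i x]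
      by (intro measurable_If) (simp_all add: vimage_def Int_def conj_commute)
    then show ?thesis
      unfolding W_def emp_cdf_def
      by (intro borel_measurable_times borel_measurable_diff borel_measurable_sum
          borel_measurable_const)
  qed
  \<comment> \<open>The assumption \<open>meas\<close> covers only Skorohod paths, so the perturbed
    path must be one.\<close>
  have path: "(\<lambda>x. f x + W n s x / sqrt (real n)) \<in> skorohod" for n s
    using skorohod_add_scaled[OF f W[of n s], of "1 / sqrt (real n)"] by simp
  have "(\<lambda>s. \<phi> (\<lambda>x. f x + W n s x / sqrt (real n))) \<in> borel_measurable P" for n
    using W_meas path by (intro meas borel_measurable_add borel_measurable_divide borel_measurable_const)
  then have sd_meas: "(\<lambda>s. scaled_diff \<phi> f n (W n s)) \<in> borel_measurable P" for n
    unfolding scaled_diff_def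
    by (intro borel_measurable_times borel_measurable_diff borel_measurable_const)
  have "AE \<omega> in N. B \<omega> \<in> skorohod"
    by (rule weak_limit_AE_skorohod[OF P N conv W])
  then have "AE \<omega> in N. (\<lambda>n. ereal (scaled_diff \<phi> f n (B \<omega>))) \<longlonglongrightarrow> Df (B \<omega>)"
    by eventually_elim (intro scaled_diff_tendsto_if_quotient_tendsto deriv dom)
  then have "converges_in_distribution P (\<lambda>n s. scaled_diff \<phi> f n (W n s)) N (\<lambda>\<omega>. Df (B \<omega>))"
    by (rule delta_method[OF P N conv skorohod_subset_linf[OF f] sd_meas])
  then have *: "converges_in_distribution M (\<lambda>n \<omega>. scaled_diff \<phi> f n (W n (T \<omega>))) N (\<lambda>\<omega>. Df (B \<omega>))"
    using distr_random_sample[OF sample] unfolding P_def T_def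
    by (rule converges_in_distribution_transfer)
  \<comment> \<open>For positive \<open>n\<close> the perturbation cancels \<open>F\<close> and
    leaves the empirical function minus \<open>G\<close>; at \<open>n = 0\<close> the factor
    \<open>sqrt 0\<close> makes both sides vanish.\<close>
  have "scaled_diff \<phi> f n (W n (T \<omega>)) =
      sqrt (real n) * (\<phi> (\<lambda>x. emp_cdf S n \<omega> x - G x) - \<phi> f)" for n \<omega>
  proof (cases "n = 0")
    case False
    then have "(\<lambda>x. f x + W n (T \<omega>) x / sqrt (real n)) = (\<lambda>x. emp_cdf S n \<omega> x - G x)"
      by (simp add: fun_eq_iff f_eq W_def T_def emp_cdf_def)
    then show ?thesis by (simp add: scaled_diff_def)
  qed (simp add: scaled_diff_def)
  with * show ?thesis by simp
qed

theorem proposition3p1: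
  fixes MX :: "'a measure" and X :: "'a \<Rightarrow> real ^ 'd"
    and MY :: "'b measure" and Y :: "'b \<Rightarrow> real ^ 'd"
    and M :: "'c measure" and S :: "nat \<Rightarrow> 'c \<Rightarrow> real ^ 'd"
    and N :: "'e measure" and B :: "'e \<Rightarrow> ereal ^ 'd \<Rightarrow> real"
    and F G :: "ereal ^ 'd \<Rightarrow> real"
    and D :: "((ereal ^ 'd \<Rightarrow> real) \<Rightarrow> real) \<Rightarrow> nat \<Rightarrow> 'c \<Rightarrow> real"
  defines "F \<equiv> joint_cdf MX X"
    and "G \<equiv> joint_cdf MY Y"
    and "D \<equiv> \<lambda>\<phi> n \<omega>. sqrt (real n) *
           (\<phi> (\<lambda>x. emp_cdf S n \<omega> x - G x) - \<phi> (\<lambda>x. F x - G x))"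
  assumes "prob_space MX" "X \<in> borel_measurable MX" "nondegenerate MX X"
    and "prob_space MY" "Y \<in> borel_measurable MY" "nondegenerate MY Y"
    and "F \<noteq> G"
    and "random_sample M S MX X"
    and "brownian_bridge (distr MX borel X) N B"
  shows "converges_in_distribution M (D delta) N (\<lambda>\<omega>. delta_deriv (\<lambda>x. F x - G x) (B \<omega>))
       \<and> converges_in_distribution M (D sigma_sup) N (\<lambda>\<omega>. sigma_deriv (\<lambda>x. F x - G x) (B \<omega>))
       \<and> converges_in_distribution M (D alpha) N (\<lambda>\<omega>. alpha_deriv (\<lambda>x. F x - G x) (B \<omega>))"
proof -
  note F_def = F_def[THEN meta_eq_to_obj_eq] and G_def = G_def[THEN meta_eq_to_obj_eq]
  have G: "G \<in> skorohod"
    unfolding G_def using assms(7,8) by (rule joint_cdf_skorohod)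
  have neq: "joint_cdf MX X \<noteq> G"
    using \<open>F \<noteq> G\<close> by (simp add: F_def)
  note conv = empirical_delta_method[OF \<open>prob_space MX\<close> \<open>X \<in> borel_measurable MX\<close> G neq
      \<open>random_sample M S MX X\<close> \<open>brownian_bridge (distr MX borel X) N B\<close>]
  show ?thesis
    unfolding D_def F_def
    by (intro conjI conv[OF convex_lipschitz_delta borel_measurable_delta tendsto_delta_deriv]
        conv[OF convex_lipschitz_sigma_sup borel_measurable_sigma_sup tendsto_sigma_deriv]
        conv[OF convex_lipschitz_alpha borel_measurable_alpha tendsto_alpha_deriv])
qed

end
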